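(* Let $k\ge 1$ and let $\mathcal{P}=\{\{j_1^1,j_1^2\},\ldots,\{j_k^1,j_k^2\}\}$ be any pair partition of the set $[1,2k]=\{1,\ldots,2k\}$. Then the hypergeometric integral $$L(\mathcal{P};H)=\int_{\Delta^{2k}[0,1]}\prod_{l=1}^k|s_{j_l^1}-s_{j_l^2}|^{2H-2}\,ds_1\cdots ds_{2k}$$ has a meromorphic continuation in the variable $H$ to the entire plane $\mathbf{C}$ which is holomorphic in the complement of the following union of rational progressions: $$\left\{1-\frac{|S|+l}{2[S|\mathcal{P}]}\;:\;S\subset[1,2k],\ [S|\mathcal{P}]>0,\ l=0,1,2,\ldots\right\}\subset\mathbf{Q}.$$
   Context: A pair partition of $\{1,\ldots,2k\}$ is a partition of this set into $k$ blocks of size two. $\Delta^{2k}[0,1]=\{t\in\mathbf{R}^{2k}:0<t_1<\cdots<t_{2k}<1\}$ is the increasing simplex. The integral $L(\mathcal{P};H)$ is initially defined for $\operatorname{Re}H>1/2$; a meromorphic continuation is a meromorphic function of $H\in\mathbf{C}$ agreeing with this integral there. For natural numbers $a\le b$, $[a,b]=\{a,a+1,\ldots,b\}$. For a pair $\{j^1,j^2\}\subset\{1,\ldots,2k\}$ with $j^1\neq j^2$, set $I(\{j^1,j^2\})=[\min(j^1,j^2)+1,\ \max(j^1,j^2)]\subset\{2,\ldots,2k\}$. For a pair partition $\mathcal{P}$, $\mathcal{I}(\mathcal{P})=\{I(\{j^1,j^2\}):\{j^1,j^2\}\in\mathcal{P}\}$, a set of $k$ subintervals of $\{2,\ldots,2k\}$.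 For $S\subset\{1,\ldots,2k\}$, $[S|\mathcal{P}]$ denotes the number of subsets of $S$ which are elements of $\mathcal{I}(\mathcal{P})$. $|S|$ is the cardinality of $S$. *)

theory Defs
  imports "HOL-Complex_Analysis.Complex_Analysis" "HOL-Library.Disjoint_Sets"
begin

definition pair_partition :: "nat \<Rightarrow> nat set set \<Rightarrow> bool" where
  "pair_partition k P \<longleftrightarrow>
     partition_on {1..2*k} P \<and> card P = k \<and> (\<forall>B\<in>P. card B = 2)"

(* Vectors of R^n are extensional functions on {1..n}. *)
abbreviation lborel_vec :: "nat \<Rightarrow> (nat \<Rightarrow> real) measure" where
  "lborel_vec n \<equiv> (\<Pi>\<^sub>M i\<in>{1..n}. lborel)"

definition incr_simplex :: "nat \<Rightarrow> (nat \<Rightarrow> real) set" where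
  "incr_simplex n =
     {t \<in> space (lborel_vec n). 0 < t 1 \<and> (\<forall>i\<in>{1..<n}. t i < t (i + 1)) \<and> t n < 1}"

(* For a block B = {a, b}, the factor |s a - s b| is written via Min B and Max B.
   On the simplex it is positive, so powr (principal branch) is exp ((2H - 2) ln |s a - s b|). *)
definition hyp_integrand :: "nat set set \<Rightarrow> complex \<Rightarrow> (nat \<Rightarrow> real) \<Rightarrow> complex" where
  "hyp_integrand P H s =
     (\<Prod>B\<in>P. complex_of_real \<bar>s (Min B) - s (Max B)\<bar> powr (2 * H - 2))"

definition hyp_integral :: "nat \<Rightarrow> nat set set \<Rightarrow> complex \<Rightarrow> complex" where
  "hyp_integral k P H =
     (LINT s:incr_simplex (2*k)|lborel_vec (2*k). hyp_integrand P H s)"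

definition pair_interval :: "nat set \<Rightarrow> nat set" where
  "pair_interval B = {Min B + 1..Max B}"

definition pair_intervals :: "nat set set \<Rightarrow> nat set set" where
  "pair_intervals P = pair_interval ` P"

(* The number written [S|P]. *)
definition bracket :: "nat set \<Rightarrow> nat set set \<Rightarrow> nat" where
  "bracket S P = card {J. J \<subseteq> S \<and> J \<in> pair_intervals P}"

definition progressions :: "nat \<Rightarrow> nat set set \<Rightarrow> complex set" where
  "progressions k P =
     {1 - of_nat (card S + l) / of_nat (2 * bracket S P) | S l.
        S \<subseteq> {1..2*k} \<and> bracket S P > 0}"

end

theory Submission
  imports Defs "HOL-Real_Asymp.Real_Asymp"
begin

text \<open>
  In the increments \<open>w\<^sub>i = s\<^sub>i - s\<^sub>i\<^sub>-\<^sub>1\<close> the factors of the integrand become powers of the linear forms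
  \<open>L\<^sub>T = \<Sum>i\<in>T. w\<^sub>i\<close> with \<open>T\<close> an interval of the partition. Consider, for arbitrary complex exponents \<open>b\<^sub>T\<close>,
  the integral \<open>J(b)\<close> of \<open>exp (-L\<^sub>A) \<Prod>T. L\<^sub>T powr b\<^sub>T\<close> over the positive orthant. Power counting shows that it
  converges when the real parts of all \<open>c\<^sub>S(b) = |S| + (\<Sum>T\<subseteq>S. b\<^sub>T)\<close> are positive. Integrating the divergence of
  \<open>(w\<^sub>i)\<close>, \<open>i \<in> S\<close>, times the integrand gives a relation that expresses \<open>c\<^sub>S(b) J(b)\<close> through integrals
  for which \<open>c\<^sub>S\<close> is larger by one and no other \<open>c\<close> is smaller. For exponents that are affine in \<open>H\<close>, iteration shows
  that \<open>J(b) / \<Prod>S. Gamma (c\<^sub>S(b))\<close> is entire, and the zeros of the \<open>c\<^sub>S + l\<close> are the asserted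
  progressions. Finally, by homogeneity, \<open>J\<close> is a Gamma factor times the integral over the simplex.
\<close>

section \<open>Power counting\<close>

text \<open>The simplex has the face \<open>s (2*k) = 1\<close>, where integration by parts would
  leave boundary terms. With the weight \<open>exp (-L)\<close> on the whole orthant they vanish at
  both ends of every coordinate line. Exponents are needed for all nonempty subsets, although the
  partition only supplies intervals: the divergence over \<open>S\<close> turns a form that meets
  \<open>S\<close> without lying in it into the quotient of the forms of \<open>S \<inter> T\<close>
  and \<open>T\<close>, so the family must be closed under intersection with any \<open>S\<close>.
  Trading \<open>T\<close> for \<open>S \<inter> T\<close> lowers no scaling exponent because every
  set containing \<open>T\<close> contains \<open>S \<inter> T\<close>. Reciprocal Gamma functions
  are the right normalisation since \<open>rGamma c = c * rGamma (c + 1)\<close> produces the very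
  factor \<open>c\<close> that the relation asks for, and their zeros list all poles
  \<open>c = -l\<close> at once. The half plane \<open>Re H > 1/2\<close> comes from
  \<open>bracket S P \<le> card S\<close>: distinct intervals have distinct right ends. The last
  Gamma factor is divided out by an entire function, so it creates no pole.\<close>

definition subs :: "'i set \<Rightarrow> 'i set set" where
  "subs A = Pow A - {{}}"

text \<open>The scaling exponent at the locus where all \<open>w i\<close> with \<open>i\<close> in
  \<open>S\<close> shrink together: \<open>card S\<close> from the volume, \<open>b T\<close> from
  each form that vanishes there; forms with \<open>T\<close> not inside \<open>S\<close> stay away
  from zero. The ring is general because real, complex and integer exponents all occur.\<close>

definition scal_dim :: "('i set \<Rightarrow> 'a::comm_ring_1) \<Rightarrow> 'i set \<Rightarrow> 'a" where
  "scal_dim b S = of_nat (card S) + sum b (subs S)"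

lemma finite_subs [simp, intro]: "finite A \<Longrightarrow> finite (subs A)"
  by (simp add: subs_def)

lemma subs_empty [simp]: "subs {} = {}"
  by (auto simp: subs_def)

lemma subs_mono: "A \<subseteq> B \<Longrightarrow> subs A \<subseteq> subs B"
  by (auto simp: subs_def)

lemma self_in_subs: "A \<noteq> {} \<Longrightarrow> A \<in> subs A"
  by (auto simp: subs_def)

lemma sum_subs_insert:
  fixes g :: "'i set \<Rightarrow> 'a::comm_monoid_add"
  assumes "finite A" "a \<notin> A"
  shows "sum g (subs (insert a A)) = sum g (subs A) + (\<Sum>T\<in>Pow A. g (insert a T))"
proof -
  have "subs (insert a A) = subs A \<union> insert a ` Pow A"
    by (auto simp: subs_def Pow_insert)
  moreover have "subs A \<inter> insert a ` Pow A = {}" using assms by (auto simp: subs_def)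
  moreover have "inj_on (insert a) (Pow A)"
    using assms by (auto simp: inj_on_def)
  ultimately show ?thesis using assms
    by (simp add: sum.union_disjoint sum.reindex)
qed

text \<open>Each linear form is comparable to its largest variable; \<open>x\<close> plays the role of the logarithms of the
  variables. The induction adds the variables in increasing order.\<close>

lemma sum_Max_le_scal_dim:
  fixes b :: "'i set \<Rightarrow> real" and x :: "'i \<Rightarrow> real"
  assumes "finite A" "A \<noteq> {}" "\<And>S. S \<in> subs A \<Longrightarrow> e \<le> scal_dim b S"
  shows "(\<Sum>T\<in>subs A. b T * Max (x ` T)) + sum x A
           \<le> scal_dim b A * Max (x ` A) - e * (Max (x ` A) - Min (x ` A))"
  using assms
proof (induction A rule: finite_ranking_induct[where f = x])
  case empty
  then show ?case by simp
next
  case (insert a A)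
  show ?case
  proof (cases "a \<in> A")
    case True
    then show ?thesis using insert by (simp add: insert_absorb)
  next
    case False
    define q where "q = (\<Sum>T\<in>Pow A. b (insert a T))"
    have Max_insert_a: "Max (x ` insert a T) = x a" if "T \<subseteq> A" for T
      using that insert.hyps by (intro Max_eqI) (auto intro: finite_subset)
    have sum: "(\<Sum>T\<in>subs (insert a A). b T * Max (x ` T)) =
                 (\<Sum>T\<in>subs A. b T * Max (x ` T)) + q * x a"
      using insert.hyps(1) False Max_insert_a
      by (simp add: sum_subs_insert q_def sum_distrib_right del: image_insert)
    have dim: "scal_dim b (insert a A) = scal_dim b A + 1 + q"
      using insert.hyps(1) False by (simp add: sum_subs_insert q_def scal_dim_def)
    show ?thesis
    proof (cases "A = {}")
      case True
      then show ?thesis using sum dim by (simp add: scal_dim_def algebra_simps)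
    next
      case nonempty: False
      have e: "e \<le> scal_dim b S" if "S \<in> subs A" for S
        using that insert.prems(2) subs_mono[of A "insert a A"] by blast
      have IH: "(\<Sum>T\<in>subs A. b T * Max (x ` T)) + sum x A
           \<le> scal_dim b A * Max (x ` A) - e * (Max (x ` A) - Min (x ` A))"
        by (rule insert.IH[OF nonempty e])
      have Min: "Min (x ` insert a A) = Min (x ` A)"
      proof -
        obtain y where "y \<in> A" using nonempty by blast
        then have "Min (x ` A) \<le> x a"
          using insert.hyps by (meson Min_le finite_imageI imageI order_trans)
        then show ?thesis using insert.hyps(1) nonempty by simp
      qed
      have le: "Max (x ` A) \<le> x a" using insert.hyps nonempty by simp
      have "0 \<le> (scal_dim b A - e) * (x a - Max (x ` A))"
        using le e[OF self_in_subs[OF nonempty]] by simp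
      then show ?thesis
        unfolding sum dim Min Max_insert_a[OF order_refl]
        using IH insert.hyps(1) False by (simp add: algebra_simps)
    qed
  qed
qed

text \<open>Half of the exponential decay already beats any power at infinity; the other half is
  left for the majorant.\<close>

lemma mult_ln_le:
  fixes p :: real
  assumes "p \<ge> 0"
  obtains C where "\<And>t. t > 0 \<Longrightarrow> p * ln t \<le> C + t / 2"
proof (cases "p = 0")
  case True
  then show ?thesis using that[of 0] by simp
next
  case False
  then have p: "p > 0" using assms by simp
  have "p * ln t \<le> p * ln (2 * p) + t / 2" if "t > 0" for t
  proof -
    have "ln (t / (2 * p)) \<le> t / (2 * p)"
      using ln_le_minus_one[of "t / (2 * p)"] that p by simp
    then have "p * ln (t / (2 * p)) \<le> p * (t / (2 * p))" using p by (intro mult_left_mono) auto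
    then show ?thesis using p that by (simp add: ln_div ln_mult algebra_simps)
  qed
  then show ?thesis using that by blast
qed

text \<open>The point is a bound that splits into functions of single variables. The previous
  estimate leaves \<open>p * Max + e * Min\<close> of the logarithms: the growth in the largest
  variable is paid by half of the exponential, and the margin \<open>e\<close> at the smallest one
  is spread evenly by comparing the minimum with the mean, whence \<open>d = e / n\<close>.\<close>

lemma sum_ln_bound:
  fixes b :: "'i set \<Rightarrow> real"
  assumes fin: "finite A" and ne: "A \<noteq> {}" and pos: "\<And>S. S \<in> subs A \<Longrightarrow> 0 < scal_dim b S"
  obtains K d where "d > 0"
    "\<And>w. (\<And>i. i \<in> A \<Longrightarrow> 0 < w i) \<Longrightarrow>
       (\<Sum>T\<in>subs A. b T * ln (sum w T)) - sum w A \<le> K + (\<Sum>i\<in>A. (d - 1) * ln (w i) - w i / 2)"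
proof -
  define n where "n = real (card A)"
  have n: "n \<ge> 1" using fin ne by (simp add: n_def Suc_le_eq card_gt_0_iff)
  define e where "e = Min (scal_dim b ` subs A)"
  have sne: "subs A \<noteq> {}" using self_in_subs[OF ne] by auto
  have e_pos: "e > 0" unfolding e_def using fin sne pos by (subst Min_gr_iff) auto
  have e_le: "e \<le> scal_dim b S" if "S \<in> subs A" for S
    unfolding e_def using fin that by auto
  define p where "p = scal_dim b A - e"
  have p: "p \<ge> 0" using e_le[OF self_in_subs[OF ne]] by (simp add: p_def)
  obtain C where C: "\<And>t. t > 0 \<Longrightarrow> p * ln t \<le> C + t / 2" using mult_ln_le[OF p] by blast
  define K where "K = C + (\<Sum>T\<in>subs A. \<bar>b T\<bar> * ln n)"
  show ?thesis
  proof (rule that[of "e / n" K])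
    show "e / n > 0" using e_pos n by simp
    fix w :: "'i \<Rightarrow> real" assume w: "\<And>i. i \<in> A \<Longrightarrow> 0 < w i"
    define x where "x = (\<lambda>i. ln (w i))"
    \<comment> \<open>A sum of positive terms lies between its largest term and \<open>n\<close>
      times that term. The sign of \<open>b T\<close> is arbitrary, hence the absolute
      value.\<close>
    have ln_diff: "b T * ln (sum w T) \<le> b T * Max (x ` T) + \<bar>b T\<bar> * ln n" if T: "T \<in> subs A" for T
    proof -
      have T': "finite T" "T \<noteq> {}" "T \<subseteq> A" using T fin by (auto simp: subs_def intro: finite_subset)
      have "Max (x ` T) \<in> x ` T" using T' by (intro Max_in) auto
      then obtain j where j: "j \<in> T" "Max (x ` T) = x j" by blast
      have wj: "w j > 0" using w j T' by auto
      have le: "w i \<le> w j" if "i \<in> T" for i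
      proof -
        have "x i \<le> x j" using j that T' by (metis Max_ge finite_imageI imageI)
        then show ?thesis using w that T' wj by (auto simp: x_def subset_iff)
      qed
      have "w j \<le> sum w T" using j T' w by (intro member_le_sum) (auto simp: less_imp_le subset_iff)
      then have 1: "x j \<le> ln (sum w T)" using wj by (simp add: x_def)
      have "sum w T \<le> card T * w j" using sum_bounded_above[of T w "w j"] le by simp
      also have "\<dots> \<le> n * w j" unfolding n_def using T' fin wj
        by (intro mult_right_mono) (auto intro: card_mono)
      finally have "ln (sum w T) \<le> ln (n * w j)"
        using \<open>w j \<le> sum w T\<close> wj by (intro ln_mono) auto
      then have 2: "ln (sum w T) \<le> ln n + x j" using n wj by (simp add: ln_mult x_def)
      have "b T * (ln (sum w T) - x j) \<le> \<bar>b T\<bar> * \<bar>ln (sum w T) - x j\<bar>"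
        by (metis abs_ge_self abs_mult)
      also have "\<dots> \<le> \<bar>b T\<bar> * ln n" using 1 2 by (intro mult_left_mono) auto
      finally show ?thesis using j by (simp add: algebra_simps)
    qed
    have "(\<Sum>T\<in>subs A. b T * ln (sum w T)) \<le> (\<Sum>T\<in>subs A. b T * Max (x ` T)) + (\<Sum>T\<in>subs A. \<bar>b T\<bar> * ln n)"
      unfolding sum.distrib[symmetric] by (intro sum_mono ln_diff)
    also have "(\<Sum>T\<in>subs A. b T * Max (x ` T)) \<le> p * Max (x ` A) + e * Min (x ` A) - sum x A"
      using sum_Max_le_scal_dim[OF fin ne e_le, of x] by (simp add: p_def algebra_simps)
    finally have 3: "(\<Sum>T\<in>subs A. b T * ln (sum w T)) \<le> p * Max (x ` A) + e * Min (x ` A) - sum x A + (K - C)"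
      by (simp add: K_def)
    have 4: "p * Max (x ` A) \<le> C + sum w A / 2"
    proof -
      have "Max (x ` A) \<in> x ` A" using fin ne by (intro Max_in) auto
      then obtain j where j: "j \<in> A" "Max (x ` A) = x j" by blast
      have "w j \<le> sum w A" using j fin w by (intro member_le_sum) (auto simp: less_imp_le)
      then show ?thesis using C[of "w j"] w j by (force simp: x_def)
    qed
    have 5: "e * Min (x ` A) \<le> e / n * sum x A"
    proof -
      have "n * Min (x ` A) \<le> sum x A"
        using sum_bounded_below[of A "Min (x ` A)" x] fin by (simp add: n_def)
      then have "e / n * (n * Min (x ` A)) \<le> e / n * sum x A" using e_pos n by (intro mult_left_mono) auto
      then show ?thesis using n by simp
    qed
    have "(\<Sum>i\<in>A. (e / n - 1) * ln (w i) - w i / 2) = (e / n - 1) * sum x A - sum w A / 2"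
      by (simp add: sum_subtractf sum_distrib_left sum_divide_distrib x_def)
    moreover have "(e / n - 1) * sum x A = e / n * sum x A - sum x A" by (simp add: left_diff_distrib)
    ultimately show "(\<Sum>T\<in>subs A. b T * ln (sum w T)) - sum w A \<le> K + (\<Sum>i\<in>A. (e / n - 1) * ln (w i) - w i / 2)"
      using 3 4 5 by linarith
  qed
qed

section \<open>Integrable majorants for products of powers of linear forms\<close>

definition gamma_kernel :: "real \<Rightarrow> real \<Rightarrow> real" where
  "gamma_kernel d x = (if x > 0 then exp ((d - 1) * ln x - x / 2) else 0)"

lemma gamma_kernel_nonneg [simp]: "gamma_kernel d x \<ge> 0"
  by (simp add: gamma_kernel_def)

lemma measurable_gamma_kernel [measurable]: "gamma_kernel d \<in> borel_measurable borel"
  unfolding gamma_kernel_def by measurable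

lemma integrable_gamma_kernel:
  assumes "d > 0"
  shows "integrable lborel (gamma_kernel d)"
proof -
  have "(\<lambda>t. complex_of_real t powr (of_real d - 1) / of_real (exp (1/2 * t))) absolutely_integrable_on {0<..}"
    using assms by (intro absolutely_integrable_Gamma_integral) auto
  then have "integrable lebesgue (\<lambda>t. norm (indicator {0<..} t *\<^sub>R (complex_of_real t powr (of_real d - 1) / of_real (exp (1/2 * t)))))"
    unfolding set_integrable_def by (rule integrable_norm)
  moreover have "norm (indicator {0<..} t *\<^sub>R (complex_of_real t powr (of_real d - 1) / of_real (exp (1/2 * t)))) = gamma_kernel d t" for t
    by (auto simp: gamma_kernel_def indicator_def norm_divide norm_powr_real_powr powr_def exp_diff)
  ultimately have "integrable lebesgue (gamma_kernel d)" by simp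
  then show ?thesis by (simp add: integrable_completion)
qed

lemma mult_gamma_kernel: "x > 0 \<Longrightarrow> x * gamma_kernel d x = exp (d * ln x - x / 2)"
  by (simp add: gamma_kernel_def left_diff_distrib exp_diff)

text \<open>These limits control the boundary terms on a coordinate line. The extra factor
  \<open>x\<close> forces the limit at 0 even for \<open>d < 1\<close>, where the kernel itself
  blows up.\<close>

lemma tendsto_mult_gamma_kernel:
  assumes "d > 0"
  shows "((\<lambda>x. x * gamma_kernel d x) \<longlongrightarrow> 0) (at_right 0)"
    and "((\<lambda>x. x * gamma_kernel d x) \<longlongrightarrow> 0) at_top"
proof -
  have "((\<lambda>x. exp (d * ln x - x / 2)) \<longlongrightarrow> 0) (at_right 0)"
    using assms by real_asymp
  then show "((\<lambda>x. x * gamma_kernel d x) \<longlongrightarrow> 0) (at_right 0)"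
    by (rule Lim_transform_eventually) (auto simp: eventually_at_filter mult_gamma_kernel)
  have "((\<lambda>x. exp (d * ln x - x / 2)) \<longlongrightarrow> 0) at_top"
    by real_asymp
  then show "((\<lambda>x. x * gamma_kernel d x) \<longlongrightarrow> 0) at_top"
    by (rule Lim_transform_eventually) (use eventually_gt_at_top[of "0::real"] in \<open>eventually_elim, simp add: mult_gamma_kernel\<close>)
qed

text \<open>Exponentials of real logarithms avoid any choice of branch. The value 0 off the open
  orthant lets integrals run over the whole space and makes the shift identities hold at every
  point.\<close>

definition Phi :: "'i set \<Rightarrow> ('i set \<Rightarrow> complex) \<Rightarrow> ('i \<Rightarrow> real) \<Rightarrow> complex" where
  "Phi A b w = (if \<forall>i\<in>A. 0 < w i
     then exp ((\<Sum>T\<in>subs A. b T * of_real (ln (sum w T))) - of_real (sum w A)) else 0)"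

lemma measurable_sum_component [measurable]:
  assumes "T \<subseteq> A"
  shows "(\<lambda>w. sum w T :: real) \<in> borel_measurable (Pi\<^sub>M A (\<lambda>_. lborel))"
  using assms by (intro borel_measurable_sum) (auto intro!: measurable_compose[OF measurable_component_singleton[of _ A "\<lambda>_. lborel"]])

lemma measurable_Phi [measurable]:
  assumes "finite A"
  shows "Phi A b \<in> borel_measurable (Pi\<^sub>M A (\<lambda>_. lborel))"
proof -
  have [measurable]: "Measurable.pred (Pi\<^sub>M A (\<lambda>_. lborel)) (\<lambda>w. \<forall>i\<in>A. (0::real) < w i)"
    using assms by (intro pred_intros_finite) auto
  have [measurable]: "(\<lambda>w. \<Sum>T\<in>subs A. b T * of_real (ln (sum w T))) \<in> borel_measurable (Pi\<^sub>M A (\<lambda>_. lborel))"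
    by (intro borel_measurable_sum borel_measurable_times borel_measurable_const borel_measurable_of_real
        borel_measurable_ln measurable_sum_component) (auto simp: subs_def)
  have [measurable]: "(\<lambda>w. sum w A :: real) \<in> borel_measurable (Pi\<^sub>M A (\<lambda>_. lborel))"
    by (rule measurable_sum_component) simp
  show ?thesis unfolding Phi_def by measurable
qed

lemma norm_Phi:
  "norm (Phi A b w) = (if \<forall>i\<in>A. 0 < w i
     then exp ((\<Sum>T\<in>subs A. Re (b T) * ln (sum w T)) - sum w A) else 0)"
  by (simp add: Phi_def)

lemma Re_scal_dim: "Re (scal_dim b S) = scal_dim (\<lambda>T. Re (b T)) S"
  by (simp add: scal_dim_def)

text \<open>A pointwise product bound serves twice: for integrability over the whole space, and for
  the decay along a single line, where the other factors are constants.\<close>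

lemma norm_Phi_le:
  assumes "finite A" "A \<noteq> {}" "\<And>S. S \<in> subs A \<Longrightarrow> 0 < Re (scal_dim b S)"
  shows "\<exists>K d. d > 0 \<and> (\<forall>w. norm (Phi A b w) \<le> exp K * (\<Prod>i\<in>A. gamma_kernel d (w i)))"
proof -
  obtain K d where d: "d > 0" and
    K: "\<And>w. (\<And>i. i \<in> A \<Longrightarrow> 0 < w i) \<Longrightarrow>
       (\<Sum>T\<in>subs A. Re (b T) * ln (sum w T)) - sum w A \<le> K + (\<Sum>i\<in>A. (d - 1) * ln (w i) - w i / 2)"
    by (rule sum_ln_bound[OF assms(1,2), of "\<lambda>T. Re (b T)"]) (use assms(3) in \<open>auto simp: Re_scal_dim\<close>)
  have "norm (Phi A b w) \<le> exp K * (\<Prod>i\<in>A. gamma_kernel d (w i))" for w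
  proof (cases "\<forall>i\<in>A. 0 < w i")
    case True
    then have "(\<Prod>i\<in>A. gamma_kernel d (w i)) = exp (\<Sum>i\<in>A. (d - 1) * ln (w i) - w i / 2)"
      using assms(1) by (simp add: gamma_kernel_def exp_sum)
    then show ?thesis using K[of w] True by (simp add: norm_Phi flip: exp_add)
  next
    case False
    then show ?thesis by (auto simp: norm_Phi intro!: mult_nonneg_nonneg prod_nonneg)
  qed
  with d show ?thesis by blast
qed

lemma product_sigma_finite_lborel: "product_sigma_finite (\<lambda>_. lborel)"
  by (simp add: product_sigma_finite_def sigma_finite_lborel)

lemma integrable_Phi:
  assumes "finite A" "A \<noteq> {}" "\<And>S. S \<in> subs A \<Longrightarrow> 0 < Re (scal_dim b S)"
  shows "integrable (Pi\<^sub>M A (\<lambda>_. lborel)) (Phi A b)"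
proof -
  obtain K d where d: "d > 0" and le: "\<And>w. norm (Phi A b w) \<le> exp K * (\<Prod>i\<in>A. gamma_kernel d (w i))"
    using norm_Phi_le[OF assms] by blast
  interpret product_sigma_finite "\<lambda>_. lborel :: real measure"
    by (rule product_sigma_finite_lborel)
  have "integrable (Pi\<^sub>M A (\<lambda>_. lborel)) (\<lambda>w. \<Prod>i\<in>A. gamma_kernel d (w i))"
    using assms(1) integrable_gamma_kernel[OF d] by (rule product_integrable_prod)
  then have "integrable (Pi\<^sub>M A (\<lambda>_. lborel)) (\<lambda>w. exp K * (\<Prod>i\<in>A. gamma_kernel d (w i)))"
    by (rule integrable_mult_right)
  then show ?thesis
  proof (rule Bochner_Integration.integrable_bound)
    have "norm (Phi A b w) \<le> norm (exp K * (\<Prod>i\<in>A. gamma_kernel d (w i)))" for w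
      using order_trans[OF le abs_ge_self] by simp
    then show "AE w in Pi\<^sub>M A (\<lambda>_. lborel). norm (Phi A b w) \<le> norm (exp K * (\<Prod>i\<in>A. gamma_kernel d (w i)))"
      by (rule AE_I2)
  qed (rule measurable_Phi[OF assms(1)])
qed

lemma scal_dim_upd:
  assumes "finite S"
  shows "scal_dim (b(T := b T + d)) S = scal_dim b S + (if T \<in> subs S then d else 0)"
proof (cases "T \<in> subs S")
  case True
  then show ?thesis using assms by (simp add: scal_dim_def sum.remove[of "subs S" T])
next
  case False
  then show ?thesis using assms by (auto simp: scal_dim_def intro!: sum.cong)
qed

lemma Phi_upd:
  assumes "finite A" "S \<in> subs A"
  shows "Phi A (b(S := b S + 1)) w = Phi A b w * of_real (sum w S)"
    and "Phi A (b(S := b S - 1)) w = Phi A b w / of_real (sum w S)"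
proof -
  have S: "sum w S > 0" if "\<forall>i\<in>A. 0 < w i"
    using assms that by (intro sum_pos) (auto simp: subs_def intro: finite_subset)
  have *: "(\<Sum>T\<in>subs A. (b(S := b S + c)) T * of_real (ln (sum w T))) =
        (\<Sum>T\<in>subs A. b T * of_real (ln (sum w T))) + c * of_real (ln (sum w S))" for c
  proof -
    have "(\<Sum>T\<in>subs A. (b(S := b S + c)) T * of_real (ln (sum w T))) =
        (\<Sum>T\<in>subs A. b T * of_real (ln (sum w T)) + (if T = S then c * of_real (ln (sum w S)) else 0))"
      by (intro sum.cong) (auto simp: algebra_simps)
    then show ?thesis using assms by (simp add: sum.distrib)
  qed
  have ln_exp: "exp (complex_of_real (ln (sum w S))) = of_real (sum w S)" if "\<forall>i\<in>A. 0 < w i"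
    using S[OF that] by (simp add: exp_of_real)
  show "Phi A (b(S := b S + 1)) w = Phi A b w * of_real (sum w S)"
    unfolding Phi_def * by (auto simp: exp_diff exp_add ln_exp)
  show "Phi A (b(S := b S - 1)) w = Phi A b w / of_real (sum w S)"
    using *[of "-1"] S by (auto simp: Phi_def exp_diff ln_exp)
qed

section \<open>Integration by parts\<close>

lemma integrable_Phi_times:
  fixes g :: "('i \<Rightarrow> real) \<Rightarrow> complex"
  assumes "finite A" "A \<noteq> {}" "\<And>S. S \<in> subs A \<Longrightarrow> 0 < Re (scal_dim b S)"
  assumes "g \<in> borel_measurable (Pi\<^sub>M A (\<lambda>_. lborel))"
  assumes "\<And>w. \<forall>i\<in>A. 0 < w i \<Longrightarrow> norm (g w) \<le> 1"
  shows "integrable (Pi\<^sub>M A (\<lambda>_. lborel)) (\<lambda>w. Phi A b w * g w)"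
proof (rule Bochner_Integration.integrable_bound[OF integrable_Phi[OF assms(1-3)]])
  show "(\<lambda>w. Phi A b w * g w) \<in> borel_measurable (Pi\<^sub>M A (\<lambda>_. lborel))"
    using assms(1,4) by measurable
  have "norm (Phi A b w * g w) \<le> norm (Phi A b w)" for w
    using assms(5)[of w] by (auto simp: norm_mult Phi_def mult_left_le)
  then show "AE w in Pi\<^sub>M A (\<lambda>_. lborel). norm (Phi A b w * g w) \<le> norm (Phi A b w)"
    by simp
qed

text \<open>The derivative of \<open>w\<^sub>i * Phi A b w\<close> in the direction \<open>i\<close>.\<close>

definition Phi_deriv :: "'i \<Rightarrow> 'i set \<Rightarrow> ('i set \<Rightarrow> complex) \<Rightarrow> ('i \<Rightarrow> real) \<Rightarrow> complex" where
  "Phi_deriv i A b w = Phi A b w * (1 - of_real (w i) +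
     (\<Sum>T\<in>subs A. b T * of_real (sum w ({i} \<inter> T) / sum w T)))"

text \<open>Positivity of the variables bounds the quotient by 1, so each quotient term of the
  relation converges wherever \<open>Phi\<close> itself does, although an exponent has been
  lowered.\<close>

lemma ratio_bounds:
  fixes w :: "'i \<Rightarrow> real"
  assumes "finite A" "T \<in> subs A" "\<forall>i\<in>A. 0 < w i"
  shows "0 \<le> sum w (S \<inter> T) / sum w T" "sum w (S \<inter> T) / sum w T \<le> 1" "sum w T > 0"
proof -
  have T: "finite T" "T \<noteq> {}" "T \<subseteq> A" using assms by (auto simp: subs_def intro: finite_subset)
  show 1: "sum w T > 0" using T assms(3) by (intro sum_pos) auto
  have "sum w (S \<inter> T) \<le> sum w T" using T assms(3)
    by (intro sum_mono2) (auto intro: less_imp_le)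
  moreover have "0 \<le> sum w (S \<inter> T)" using T assms(3)
    by (intro sum_nonneg) (auto intro: less_imp_le)
  ultimately show "0 \<le> sum w (S \<inter> T) / sum w T" "sum w (S \<inter> T) / sum w T \<le> 1"
    using 1 by auto
qed

lemma scal_dim_upd_pos:
  assumes "finite A" "S \<in> subs A" "0 < Re (scal_dim b S)"
  shows "0 < Re (scal_dim (b(T := b T + 1)) S)"
proof -
  have "finite S" using assms by (auto simp: subs_def intro: finite_subset)
  then show ?thesis using assms(3) by (simp add: scal_dim_upd)
qed

lemma integrable_Phi_sum:
  assumes "finite A" "A \<noteq> {}" "\<And>S. S \<in> subs A \<Longrightarrow> 0 < Re (scal_dim b S)" "T \<in> subs A"
  shows "integrable (Pi\<^sub>M A (\<lambda>_. lborel)) (\<lambda>w. Phi A b w * of_real (sum w T))"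
  unfolding Phi_upd(1)[OF assms(1,4), symmetric]
  using assms by (intro integrable_Phi scal_dim_upd_pos) auto

lemma integrable_Phi_ratio:
  assumes "finite A" "A \<noteq> {}" "\<And>S. S \<in> subs A \<Longrightarrow> 0 < Re (scal_dim b S)" "T \<in> subs A"
  shows "integrable (Pi\<^sub>M A (\<lambda>_. lborel)) (\<lambda>w. Phi A b w * of_real (sum w (S \<inter> T) / sum w T))"
proof (rule integrable_Phi_times[OF assms(1-3)])
  have "(\<lambda>w::'a \<Rightarrow> real. sum w (S \<inter> T) / sum w T) \<in> borel_measurable (Pi\<^sub>M A (\<lambda>_. lborel))"
    by (intro borel_measurable_divide measurable_sum_component) (use assms(4) in \<open>auto simp: subs_def\<close>)
  then show "(\<lambda>w. complex_of_real (sum w (S \<inter> T) / sum w T)) \<in> borel_measurable (Pi\<^sub>M A (\<lambda>_. lborel))"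
    by (rule measurable_compose[OF _ borel_measurable_of_real])
  show "norm (complex_of_real (sum w (S \<inter> T) / sum w T)) \<le> 1" if "\<forall>i\<in>A. 0 < w i" for w
    using ratio_bounds(1,2)[OF assms(1,4) that, of S] by (simp only: norm_of_real abs_of_nonneg)
qed

lemma integrable_Phi_deriv:
  assumes "finite A" "\<And>S. S \<in> subs A \<Longrightarrow> 0 < Re (scal_dim b S)" "i \<in> A"
  shows "integrable (Pi\<^sub>M A (\<lambda>_. lborel)) (Phi_deriv i A b)"
proof -
  have ne: "A \<noteq> {}" and i: "{i} \<in> subs A" using assms(3) by (auto simp: subs_def)
  have "Phi_deriv i A b = (\<lambda>w. Phi A b w - Phi A b w * of_real (sum w {i}) +
     (\<Sum>T\<in>subs A. b T * (Phi A b w * of_real (sum w ({i} \<inter> T) / sum w T))))"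
    by (auto simp: Phi_deriv_def algebra_simps sum_distrib_left)
  moreover have "integrable (Pi\<^sub>M A (\<lambda>_. lborel)) \<dots>"
    by (intro Bochner_Integration.integrable_add Bochner_Integration.integrable_diff
       Bochner_Integration.integrable_sum integrable_mult_right integrable_Phi_ratio integrable_Phi_sum integrable_Phi assms ne i)
  ultimately show ?thesis by simp
qed

lemma has_vector_derivative_Phi_slice:
  assumes "finite A" "i \<in> A" "\<forall>j\<in>A-{i}. 0 < w j" "x > 0"
  shows "((\<lambda>x. of_real x * Phi A b (w(i := x))) has_vector_derivative Phi_deriv i A b (w(i := x))) (at x)"
proof -
  \<comment> \<open>\<open>G\<close> drops the positivity test, so the differentiation rules apply;
    it agrees with the slice of \<open>Phi\<close> on the open half line
    \<open>{0<..}\<close>.\<close>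
  define G where "G = (\<lambda>x. exp ((\<Sum>T\<in>subs A. b T * of_real (ln (sum (w(i := x)) T))) - of_real (sum (w(i := x)) A)) :: complex)"
  have Phi_G: "Phi A b (w(i := y)) = G y" if "y > 0" for y
    using assms that by (auto simp: Phi_def G_def)
  have der_sum: "((\<lambda>x. sum (w(i := x)) T) has_vector_derivative (if i \<in> T then 1 else 0)) (at x)" if "T \<subseteq> A" for T
  proof (cases "i \<in> T")
    case True
    have "finite T" using that assms finite_subset by blast
    have "((\<lambda>x. x + sum w (T - {i})) has_vector_derivative 1) (at x)" by (auto intro!: derivative_eq_intros)
    moreover have "(\<lambda>x. sum (w(i := x)) T) = (\<lambda>x. x + sum w (T - {i}))"
      using True \<open>finite T\<close> by (auto simp: sum.remove[of T i])
    ultimately show ?thesis using True by simp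
  next
    case False
    then have "(\<lambda>x. sum (w(i := x)) T) = (\<lambda>x. sum w T)"
      by (auto intro!: sum.cong)
    then show ?thesis using False by simp
  qed
  have pos: "\<forall>j\<in>A. 0 < (w(i := x)) j" using assms by auto
  have der_ln: "((\<lambda>x. complex_of_real (ln (sum (w(i := x)) T))) has_vector_derivative
      of_real ((if i \<in> T then 1 else 0) / sum (w(i := x)) T)) (at x)" if T: "T \<in> subs A" for T
  proof -
    have "sum (w(i := x)) T > 0" using ratio_bounds(3)[OF assms(1) T pos] .
    moreover have "((\<lambda>x. sum (w(i := x)) T) has_real_derivative (if i \<in> T then 1 else 0)) (at x)"
      using der_sum[of T] T by (auto simp: subs_def has_real_derivative_iff_has_vector_derivative)
    ultimately have "((\<lambda>x. ln (sum (w(i := x)) T)) has_real_derivative (if i \<in> T then 1 else 0) / sum (w(i := x)) T) (at x)"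
      using DERIV_chain2[OF DERIV_ln] by (fastforce simp: field_simps)
    then show ?thesis
      by (intro has_vector_derivative_of_real) (simp add: has_real_derivative_iff_has_vector_derivative)
  qed
  define D where "D = (\<Sum>T\<in>subs A. b T * of_real ((if i \<in> T then 1 else 0) / sum (w(i := x)) T)) - 1"
  have "((\<lambda>x. (\<Sum>T\<in>subs A. b T * of_real (ln (sum (w(i := x)) T))) - of_real (sum (w(i := x)) A)) has_vector_derivative D) (at x)"
    unfolding D_def using assms(2)
    by (intro has_vector_derivative_diff has_vector_derivative_sum has_vector_derivative_mult_right der_ln)
       (use has_vector_derivative_of_real[of "\<lambda>x. sum (w(i := x)) A" 1] der_sum[of A] in \<open>auto simp: has_real_derivative_iff_has_vector_derivative\<close>)
  then have "(G has_vector_derivative D * G x) (at x)"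
    unfolding G_def by (rule field_vector_diff_chain_at[unfolded o_def]) (auto intro!: derivative_eq_intros)
  then have "((\<lambda>x. of_real x * G x) has_vector_derivative of_real x * (D * G x) + 1 * G x) (at x)"
    by (intro has_vector_derivative_mult) (auto intro!: derivative_eq_intros)
  moreover have "of_real x * (D * G x) + 1 * G x = Phi_deriv i A b (w(i := x))"
  proof -
    have "sum (w(i := x)) ({i} \<inter> T) = (if i \<in> T then x else 0)" for T by auto
    then show ?thesis
      using Phi_G[OF assms(4)] by (auto simp: Phi_deriv_def D_def algebra_simps sum_distrib_left intro!: sum.cong)
  qed
  ultimately show ?thesis
    using assms(4) Phi_G
    by (auto intro: has_vector_derivative_transform_within_open[of _ _ _ "{0<..}"])
qed

lemma continuous_Phi_deriv_slice:
  assumes "finite A" "i \<in> A" "\<forall>j\<in>A-{i}. 0 < w j" "x > 0"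
  shows "isCont (\<lambda>x. Phi_deriv i A b (w(i := x))) x"
proof -
  let ?F = "\<lambda>x. of_real x * Phi A b (w(i := x))"
  have pos: "\<forall>j\<in>A. 0 < (w(i := x)) j" using assms by auto
  have "isCont ?F x"
    using has_vector_derivative_continuous[OF has_vector_derivative_Phi_slice[OF assms]] .
  \<comment> \<open>Continuity of \<open>Phi\<close> on the slice is recovered from
    differentiability of \<open>y * Phi\<close> by dividing by \<open>y\<close>, which is nonzero
    near \<open>x\<close>.\<close>
  then have "isCont (\<lambda>y. ?F y / of_real y) x"
    using assms(4) by (intro continuous_divide continuous_of_real continuous_ident) auto
  moreover have ev: "\<forall>\<^sub>F y in nhds x. ?F y / of_real y = Phi A b (w(i := y))"
  proof -
    have "\<forall>\<^sub>F y in nhds x. y \<in> {0<..}" using assms(4) by (intro eventually_nhds_in_open) auto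
    then show ?thesis by eventually_elim auto
  qed
  ultimately have 1: "isCont (\<lambda>y. Phi A b (w(i := y))) x"
    by (subst (asm) isCont_cong[OF ev])
  have 2: "isCont (\<lambda>y. sum (w(i := y)) T) x" for T
  proof (rule continuous_sum)
    show "isCont (\<lambda>y. (w(i := y)) j) x" for j by (cases "j = i") auto
  qed
  show ?thesis
    unfolding Phi_deriv_def
    by (intro continuous_intros 1 2) (use ratio_bounds(3)[OF assms(1) _ pos] in \<open>force+\<close>)
qed

text \<open>By Fubini it suffices to integrate along lines in direction \<open>i\<close>. There the
  integrand is the derivative of \<open>w i * Phi\<close>, which tends to 0 at both ends: at
  infinity through the exponential, at 0 through the factor \<open>w i\<close>.\<close>

lemma integral_Phi_deriv:
  assumes fin: "finite A" and pos: "\<And>S. S \<in> subs A \<Longrightarrow> 0 < Re (scal_dim b S)" and i: "i \<in> A"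
  shows "(LINT w|Pi\<^sub>M A (\<lambda>_. lborel). Phi_deriv i A b w) = 0"
proof -
  interpret product_sigma_finite "\<lambda>_. lborel :: real measure"
    by (rule product_sigma_finite_lborel)
  define I where "I = A - {i}"
  have I: "finite I" "i \<notin> I" and A: "A = insert i I" using fin i by (auto simp: I_def)
  have ne: "A \<noteq> {}" using i by auto
  obtain K d where d: "d > 0" and le: "\<And>w. norm (Phi A b w) \<le> exp K * (\<Prod>i\<in>A. gamma_kernel d (w i))"
    using norm_Phi_le[OF fin ne pos] by blast
  have slice: "(LINT y|lborel. Phi_deriv i A b (w(i := y))) = 0" for w :: "'a \<Rightarrow> real"
  proof (cases "(\<forall>j\<in>I. 0 < w j) \<and> integrable lborel (\<lambda>y. Phi_deriv i A b (w(i := y)))")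
    case True
    then have w: "\<forall>j\<in>A-{i}. 0 < w j" and int: "integrable lborel (\<lambda>y. Phi_deriv i A b (w(i := y)))"
      by (auto simp: I_def)
    let ?F = "\<lambda>y. of_real y * Phi A b (w(i := y))"
    define C where "C = exp K * (\<Prod>j\<in>I. gamma_kernel d (w j))"
    have F_le: "norm (?F y) \<le> C * (y * gamma_kernel d y)" if "y > 0" for y
    proof -
      have prod_eq: "(\<Prod>j\<in>A. gamma_kernel d ((w(i := y)) j)) = gamma_kernel d y * (\<Prod>j\<in>I. gamma_kernel d (w j))"
        unfolding A using I by (simp, intro disjI2 prod.cong) auto
      have "y * norm (Phi A b (w(i := y))) \<le> y * (exp K * (\<Prod>j\<in>A. gamma_kernel d ((w(i := y)) j)))"
        using that by (intro mult_left_mono le) auto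
      also have "\<dots> = C * (y * gamma_kernel d y)" unfolding prod_eq C_def by (simp add: mult_ac)
      finally show ?thesis using that by (simp add: norm_mult)
    qed
    have lim0: "(?F \<longlongrightarrow> 0) (at_right 0)"
    proof (rule Lim_null_comparison)
      show "\<forall>\<^sub>F y in at_right 0. norm (?F y) \<le> C * (y * gamma_kernel d y)"
        unfolding eventually_at_filter using F_le by auto
      show "((\<lambda>y. C * (y * gamma_kernel d y)) \<longlongrightarrow> 0) (at_right 0)"
        using tendsto_mult_right_zero[OF tendsto_mult_gamma_kernel(1)[OF d]] .
    qed
    have lim_top: "(?F \<longlongrightarrow> 0) at_top"
    proof (rule Lim_null_comparison)
      show "\<forall>\<^sub>F y in at_top. norm (?F y) \<le> C * (y * gamma_kernel d y)"
        using eventually_gt_at_top[of 0] by eventually_elim (rule F_le)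
      show "((\<lambda>y. C * (y * gamma_kernel d y)) \<longlongrightarrow> 0) at_top"
        using tendsto_mult_right_zero[OF tendsto_mult_gamma_kernel(2)[OF d]] .
    qed
    have zero: "Phi_deriv i A b (w(i := y)) = 0" if "y \<le> 0" for y
      using that i by (auto simp: Phi_deriv_def Phi_def)
    have restrict: "indicator {0<..} y *\<^sub>R Phi_deriv i A b (w(i := y)) = Phi_deriv i A b (w(i := y))" for y
      using zero[of y] by (auto simp: indicator_def)
    have "(LBINT y=0..\<infinity>. Phi_deriv i A b (w(i := y))) = 0 - 0"
    proof (rule interval_integral_FTC_integrable[where F = ?F])
      show "set_integrable lborel (einterval 0 \<infinity>) (\<lambda>y. Phi_deriv i A b (w(i := y)))"
        using int by (simp add: set_integrable_def zero_ereal_def restrict)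
      show "((?F \<circ> real_of_ereal) \<longlongrightarrow> 0) (at_right 0)" "((?F \<circ> real_of_ereal) \<longlongrightarrow> 0) (at_left \<infinity>)"
        using lim0 lim_top by (simp_all add: ereal_tendsto_simps zero_ereal_def)
    qed (use has_vector_derivative_Phi_slice[OF fin i w] continuous_Phi_deriv_slice[OF fin i w] in \<open>auto simp: zero_ereal_def\<close>)
    then show ?thesis
      by (simp add: interval_lebesgue_integral_def set_lebesgue_integral_def zero_ereal_def restrict)
  next
    case False
    \<comment> \<open>A slice that fails to be integrable has Bochner integral 0, so no almost-everywhere argument is needed.\<close>
    then consider "\<not> (\<forall>j\<in>I. 0 < w j)" | "\<not> integrable lborel (\<lambda>y. Phi_deriv i A b (w(i := y)))" by blast
    then show ?thesis
    proof cases
      case 1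
      then have "Phi_deriv i A b (w(i := y)) = 0" for y
        using I A by (auto simp: Phi_deriv_def Phi_def)
      then show ?thesis by simp
    qed (rule not_integrable_integral_eq)
  qed
  have "(LINT w|Pi\<^sub>M A (\<lambda>_. lborel). Phi_deriv i A b w) =
        (LINT w|Pi\<^sub>M I (\<lambda>_. lborel). LINT y|lborel. Phi_deriv i A b (w(i := y)))"
    using product_integral_insert[OF I, of "Phi_deriv i A b"] integrable_Phi_deriv[OF fin pos i]
    unfolding A by simp
  then show ?thesis by (simp add: slice)
qed

definition Jint :: "'i set \<Rightarrow> ('i set \<Rightarrow> complex) \<Rightarrow> complex" where
  "Jint A b = (LINT w|Pi\<^sub>M A (\<lambda>_. lborel). Phi A b w)"

text \<open>Sum the vanishing integrals of \<open>Phi_deriv i\<close> over \<open>i\<close> in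
  \<open>S\<close>. The factors \<open>w i\<close> give \<open>card S\<close>, the exponential gives
  the shift at \<open>S\<close>, and by Euler's identity a form with \<open>T \<subseteq> S\<close>
  gives \<open>b T\<close> in full. A form with \<open>T\<close> disjoint from \<open>S\<close>
  gives nothing; the remaining ones give quotients, that is, shifts of two exponents.\<close>

lemma scal_dim_Jint:
  assumes fin: "finite A" and pos: "\<And>S. S \<in> subs A \<Longrightarrow> 0 < Re (scal_dim b S)" and S: "S \<in> subs A"
  shows "scal_dim b S * Jint A b = Jint A (b(S := b S + 1)) -
     (\<Sum>T\<in>{T \<in> subs A. S \<inter> T \<noteq> {} \<and> \<not> T \<subseteq> S}.
        b T * Jint A ((b(T := b T - 1))(S \<inter> T := b (S \<inter> T) + 1)))"
proof -
  let ?M = "Pi\<^sub>M A (\<lambda>_. lborel :: real measure)"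
  let ?R = "{T \<in> subs A. S \<inter> T \<noteq> {} \<and> \<not> T \<subseteq> S}"
  have ne: "A \<noteq> {}" and SA: "S \<subseteq> A" and finS: "finite S"
    using S fin by (auto simp: subs_def intro: finite_subset)
  have Phi_shift: "Phi A ((b(T := b T - 1))(S \<inter> T := b (S \<inter> T) + 1)) w = Phi A b w * of_real (sum w (S \<inter> T) / sum w T)"
      if T: "T \<in> ?R" for T w
    proof -
      \<comment> \<open>Since \<open>T\<close> is not inside \<open>S\<close>, the two updates
        change different exponents and can be applied one after the other.\<close>
      have "S \<inter> T \<in> subs A" "S \<inter> T \<noteq> T" using T SA by (auto simp: subs_def)
      then show ?thesis
        using Phi_upd(1)[OF fin, of "S \<inter> T" "b(T := b T - 1)" w] Phi_upd(2)[OF fin, of T b w] T by simp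
    qed
  have "(\<Sum>i\<in>S. Phi_deriv i A b w) = scal_dim b S * Phi A b w - Phi A (b(S := b S + 1)) w +
     (\<Sum>T\<in>?R. b T * Phi A ((b(T := b T - 1))(S \<inter> T := b (S \<inter> T) + 1)) w)" for w
  proof (cases "\<forall>i\<in>A. 0 < w i")
    case False
    then have "Phi A c w = 0" for c by (auto simp: Phi_def)
    then show ?thesis by (simp add: Phi_deriv_def)
  next
    case True
    \<comment> \<open>Writing the numerator in \<open>Phi_deriv\<close> as a sum over
      \<open>{i} \<inter> T\<close> pays off here: summing over \<open>i\<close> gives the form of
      \<open>S \<inter> T\<close> without case distinctions.\<close>
    have sing: "(\<Sum>i\<in>S. sum w ({i} \<inter> T)) = sum w (S \<inter> T)" for T
    proof -
      have "sum w ({i} \<inter> T) = (if i \<in> T then w i else 0)" for i by auto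
      then show ?thesis using finS by (simp add: sum.inter_restrict Int_commute)
    qed
    have "(\<Sum>i\<in>S. Phi_deriv i A b w) = Phi A b w * (of_nat (card S) - of_real (sum w S) +
       (\<Sum>i\<in>S. \<Sum>T\<in>subs A. b T * of_real (sum w ({i} \<inter> T) / sum w T)))"
      by (simp add: Phi_deriv_def sum.distrib sum_subtractf flip: sum_distrib_left)
    also have "(\<Sum>i\<in>S. \<Sum>T\<in>subs A. b T * of_real (sum w ({i} \<inter> T) / sum w T)) =
       (\<Sum>T\<in>subs A. b T * of_real (sum w (S \<inter> T) / sum w T))"
      unfolding sing[symmetric]
      by (subst sum.swap) (simp add: sum_distrib_left sum_divide_distrib)
    also have "\<dots> = sum b (subs S) + (\<Sum>T\<in>?R. b T * of_real (sum w (S \<inter> T) / sum w T))"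
    proof -
      have "(\<Sum>T\<in>subs A. b T * of_real (sum w (S \<inter> T) / sum w T)) =
         (\<Sum>T\<in>subs S \<union> ?R. b T * of_real (sum w (S \<inter> T) / sum w T))"
        using fin SA by (intro sum.mono_neutral_right) (auto simp: subs_def)
      also have "\<dots> = (\<Sum>T\<in>subs S. b T * of_real (sum w (S \<inter> T) / sum w T)) +
         (\<Sum>T\<in>?R. b T * of_real (sum w (S \<inter> T) / sum w T))"
        using fin finS by (intro sum.union_disjoint) (auto simp: subs_def)
      also have "(\<Sum>T\<in>subs S. b T * of_real (sum w (S \<inter> T) / sum w T)) = sum b (subs S)"
      proof (rule sum.cong)
        fix T assume T: "T \<in> subs S"
        then have "S \<inter> T = T" "T \<in> subs A" using SA by (auto simp: subs_def)
        then show "b T * of_real (sum w (S \<inter> T) / sum w T) = b T"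
          using ratio_bounds(3)[OF fin _ True, of T] by simp
      qed simp
      finally show ?thesis .
    qed
    finally have *: "(\<Sum>i\<in>S. Phi_deriv i A b w) = Phi A b w * (of_nat (card S) - of_real (sum w S) +
       (sum b (subs S) + (\<Sum>T\<in>?R. b T * of_real (sum w (S \<inter> T) / sum w T))))" .
    have **: "(\<Sum>T\<in>?R. b T * Phi A ((b(T := b T - 1))(S \<inter> T := b (S \<inter> T) + 1)) w) =
       Phi A b w * (\<Sum>T\<in>?R. b T * of_real (sum w (S \<inter> T) / sum w T))"
      unfolding sum_distrib_left by (intro sum.cong refl) (simp only: Phi_shift mult_ac)
    show ?thesis
      unfolding * ** Phi_upd(1)[OF fin S] scal_dim_def by algebra
  qed
  moreover have "(LINT w|?M. (\<Sum>i\<in>S. Phi_deriv i A b w)) = 0"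
    using SA integrable_Phi_deriv[OF fin pos] integral_Phi_deriv[OF fin pos]
    by (subst Bochner_Integration.integral_sum) (auto simp: subset_iff)
  ultimately have "(LINT w|?M. scal_dim b S * Phi A b w - Phi A (b(S := b S + 1)) w +
     (\<Sum>T\<in>?R. b T * Phi A ((b(T := b T - 1))(S \<inter> T := b (S \<inter> T) + 1)) w)) = 0"
    by simp
  also have "(LINT w|?M. scal_dim b S * Phi A b w - Phi A (b(S := b S + 1)) w +
     (\<Sum>T\<in>?R. b T * Phi A ((b(T := b T - 1))(S \<inter> T := b (S \<inter> T) + 1)) w)) =
     scal_dim b S * Jint A b - Jint A (b(S := b S + 1)) +
     (\<Sum>T\<in>?R. b T * Jint A ((b(T := b T - 1))(S \<inter> T := b (S \<inter> T) + 1)))"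
  proof -
    have 1: "integrable ?M (Phi A b)" by (rule integrable_Phi[OF fin ne pos])
    have 2: "integrable ?M (Phi A (b(S := b S + 1)))"
      by (intro integrable_Phi scal_dim_upd_pos) (use fin ne pos in auto)
    have 3: "integrable ?M (Phi A ((b(T := b T - 1))(S \<inter> T := b (S \<inter> T) + 1)))" if T: "T \<in> ?R" for T
    proof -
      have "Phi A ((b(T := b T - 1))(S \<inter> T := b (S \<inter> T) + 1)) =
          (\<lambda>w. Phi A b w * of_real (sum w (S \<inter> T) / sum w T))"
        by (rule ext) (rule Phi_shift[OF T])
      then show ?thesis using integrable_Phi_ratio[OF fin ne pos, of T S] T by simp
    qed
    have 4: "integrable ?M (\<lambda>w. \<Sum>T\<in>?R. b T * Phi A ((b(T := b T - 1))(S \<inter> T := b (S \<inter> T) + 1)) w)"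
      by (intro Bochner_Integration.integrable_sum integrable_mult_right 3)
    have 5: "(LINT w|?M. (\<Sum>T\<in>?R. b T * Phi A ((b(T := b T - 1))(S \<inter> T := b (S \<inter> T) + 1)) w)) =
       (\<Sum>T\<in>?R. b T * Jint A ((b(T := b T - 1))(S \<inter> T := b (S \<inter> T) + 1)))"
      unfolding Jint_def
      by (subst Bochner_Integration.integral_sum) (intro integrable_mult_right 3, assumption, simp)
    show ?thesis
      by (subst Bochner_Integration.integral_add[OF _ 4]) (use 1 2 5 in \<open>simp_all add: Jint_def\<close>)
  qed
  finally show ?thesis by (simp add: algebra_simps)
qed

section \<open>Analytic continuation\<close>

text \<open>By Cauchy's inequality a majorant on a disc also bounds the derivatives on the
  concentric disc of half the radius, hence the difference quotients at the centre, and dominated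
  convergence applies.\<close>

lemma holomorphic_on_integral:
  fixes f :: "complex \<Rightarrow> 'a \<Rightarrow> complex"
  assumes U: "open U"
    and hol: "\<And>w. w \<in> space M \<Longrightarrow> (\<lambda>z. f z w) holomorphic_on U"
    and meas: "\<And>z. z \<in> U \<Longrightarrow> f z \<in> borel_measurable M"
    and dom: "\<And>z. z \<in> U \<Longrightarrow> \<exists>r g. 0 < r \<and> cball z r \<subseteq> U \<and> integrable M g \<and>
        (\<forall>z'\<in>cball z r. \<forall>w\<in>space M. norm (f z' w) \<le> g w)"
  shows "(\<lambda>z. \<integral>w. f z w \<partial>M) holomorphic_on U"
proof -
  have "(\<lambda>z. \<integral>w. f z w \<partial>M) field_differentiable at z" if z: "z \<in> U" for z
  proof -
    obtain r and g :: "'a \<Rightarrow> real" where r: "0 < r" "cball z r \<subseteq> U" and g: "integrable M g"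
      and le: "\<And>z' w. z' \<in> cball z r \<Longrightarrow> w \<in> space M \<Longrightarrow> norm (f z' w) \<le> g w"
      using dom[OF z] by blast
    define D where "D w = deriv (\<lambda>z. f z w) z" for w
    have int: "integrable M (f z')" if "z' \<in> cball z r" for z'
      by (rule Bochner_Integration.integrable_bound[OF g])
         (use le that r meas in \<open>force intro!: AE_I2 order_trans[OF le[OF that] abs_ge_self]\<close>)+
    have der: "((\<lambda>z. f z w) has_field_derivative deriv (\<lambda>z. f z w) z') (at z')"
      if "w \<in> space M" "z' \<in> cball z r" for w z'
      using holomorphic_derivI[OF hol[OF that(1)] U] r that by blast
    have deriv_le: "norm (deriv (\<lambda>z. f z w) z') \<le> 2 / r * g w" if w: "w \<in> space M" and z': "z' \<in> ball z (r/2)" for w z'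
    proof -
      have sub: "cball z' (r/2) \<subseteq> cball z r"
      proof
        fix y assume "y \<in> cball z' (r/2)"
        then show "y \<in> cball z r" using z' dist_triangle[of z y z'] by simp
      qed
      have "norm ((deriv ^^ 1) (\<lambda>z. f z w) z') \<le> fact 1 * g w / (r/2) ^ 1"
      proof (rule Cauchy_inequality)
        show "(\<lambda>z. f z w) holomorphic_on ball z' (r/2)"
          using hol[OF w] sub r by (meson ball_subset_cball holomorphic_on_subset order_trans)
        show "continuous_on (cball z' (r/2)) (\<lambda>z. f z w)"
          using hol[OF w] sub r by (meson holomorphic_on_imp_continuous_on holomorphic_on_subset order_trans)
        show "norm (f y w) \<le> g w" if "norm (z' - y) = r/2" for y
          using le[OF _ w, of y] sub that by (auto simp: dist_norm)
      qed (use r in auto)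
      then show ?thesis by (simp add: mult.commute)
    qed
    have "((\<lambda>y. ((\<integral>w. f y w \<partial>M) - (\<integral>w. f z w \<partial>M)) / (y - z)) \<longlongrightarrow> (\<integral>w. D w \<partial>M)) (at z within ball z (r/2))"
      unfolding tendsto_at_iff_sequentially
    proof (intro allI impI)
      fix X assume X: "\<forall>i. X i \<in> ball z (r/2) - {z}" and lim: "X \<longlonglongrightarrow> z"
      have Xc: "X i \<in> cball z r" for i using X[rule_format, of i] r by auto
      then have XU: "X i \<in> U" for i using r by blast
      define s where "s i w = (f (X i) w - f z w) / (X i - z)" for i w
      have s_meas: "s i \<in> borel_measurable M" for i
        unfolding s_def by (intro borel_measurable_divide borel_measurable_diff borel_measurable_const meas XU z)
      have s_lim: "(\<lambda>i. s i w) \<longlonglongrightarrow> D w" if w: "w \<in> space M" for w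
      proof -
        have "((\<lambda>y. (f y w - f z w) / (y - z)) \<longlongrightarrow> D w) (at z)"
          using der[OF w, of z] r unfolding D_def has_field_derivative_iff by simp
        moreover have "filterlim X (at z) sequentially"
          using lim X by (auto simp: filterlim_at)
        ultimately show ?thesis unfolding s_def by (rule filterlim_compose)
      qed
      have s_le: "norm (s i w) \<le> 2 / r * g w" if w: "w \<in> space M" for i w
      proof -
        have "norm (f (X i) w - f z w) \<le> 2 / r * g w * norm (X i - z)"
        proof (rule field_differentiable_bound)
          fix y assume y: "y \<in> ball z (r/2)"
          then have "y \<in> cball z r" using r by auto
          from der[OF w this] show "((\<lambda>z. f z w) has_field_derivative deriv (\<lambda>z. f z w) y) (at y within ball z (r/2))"
            by (rule has_field_derivative_at_within)
        qed (use X r deriv_le[OF w] in auto)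
        then show ?thesis using X by (simp add: s_def norm_divide divide_le_eq)
      qed
      have "(\<lambda>i. \<integral>w. s i w \<partial>M) \<longlonglongrightarrow> (\<integral>w. D w \<partial>M)"
      proof (rule integral_dominated_convergence)
        show "D \<in> borel_measurable M"
          by (rule borel_measurable_LIMSEQ_metric[OF s_meas s_lim])
        show "integrable M (\<lambda>w. 2 / r * g w)" using g by simp
      qed (use s_meas s_lim s_le in auto)
      moreover have "(\<integral>w. s i w \<partial>M) = ((\<integral>w. f (X i) w \<partial>M) - (\<integral>w. f z w \<partial>M)) / (X i - z)" for i
        unfolding s_def using int[OF Xc] int[of z] r by simp
      ultimately show "((\<lambda>y. ((\<integral>w. f y w \<partial>M) - (\<integral>w. f z w \<partial>M)) / (y - z)) \<circ> X) \<longlonglongrightarrow> (\<integral>w. D w \<partial>M)"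
        by (simp add: o_def)
    qed
    then have "((\<lambda>z. \<integral>w. f z w \<partial>M) has_field_derivative (\<integral>w. D w \<partial>M)) (at z within ball z (r/2))"
      unfolding has_field_derivative_iff .
    then show ?thesis
      using r at_within_open[of z "ball z (r/2)"] by (auto simp: field_differentiable_def)
  qed
  then show ?thesis
    by (simp add: holomorphic_onI field_differentiable_at_within)
qed

text \<open>This turns the two edges of a vertical strip into a majorant for everything between
  them.\<close>

lemma exp_affine_le:
  fixes a c p q x :: real
  assumes "a \<le> x" "x \<le> c"
  shows "exp (x * p + q) \<le> exp (a * p + q) + exp (c * p + q)"
proof (cases "p \<ge> 0")
  case True
  then have "exp (x * p + q) \<le> exp (c * p + q)" using assms by (simp add: mult_right_mono)
  then show ?thesis by (simp add: add_increasing)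
next
  case False
  then have "exp (x * p + q) \<le> exp (a * p + q)" using assms by (simp add: mult_right_mono_neg)
  then show ?thesis by (simp add: add_increasing2)
qed

text \<open>The modulus of \<open>Phi\<close> depends on \<open>z\<close> only through
  \<open>Re z\<close>, exponentially in an affine way. Hence two real parameters, at the left and
  right ends of the disc, yield an integrable majorant; the radius is half the distance to the
  boundary line so that both lie in the half plane.\<close>

lemma holomorphic_Jint:
  fixes m q :: "'i set \<Rightarrow> real"
  assumes fin: "finite A" and ne: "A \<noteq> {}"
    and pos: "\<And>S x. S \<in> subs A \<Longrightarrow> h < x \<Longrightarrow> 0 < scal_dim (\<lambda>T. m T * x + q T) S"
  shows "(\<lambda>z. Jint A (\<lambda>T. of_real (m T) * z + of_real (q T))) holomorphic_on {z. h < Re z}"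
  unfolding Jint_def
proof (rule holomorphic_on_integral)
  let ?b = "\<lambda>z T. of_real (m T) * z + of_real (q T)"
  show "open {z. h < Re z}" by (simp add: open_halfspace_Re_gt)
  show "(\<lambda>z. Phi A (?b z) w) holomorphic_on {z. h < Re z}" for w
  proof (cases "\<forall>i\<in>A. 0 < w i")
    case True
    then show ?thesis by (simp add: Phi_def) (intro holomorphic_intros)
  next
    case False
    then have "Phi A c w = 0" for c by (auto simp: Phi_def)
    then show ?thesis by simp
  qed
  show "Phi A (?b z) \<in> borel_measurable (Pi\<^sub>M A (\<lambda>_. lborel))" for z
    using fin by (rule measurable_Phi)
  fix z assume "z \<in> {z. h < Re z}"
  then have z: "h < Re z" by simp
  define r where "r = (Re z - h) / 2"
  define g where "g w = norm (Phi A (?b (of_real (Re z - r))) w) + norm (Phi A (?b (of_real (Re z + r))) w)" for w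
  have r: "r > 0" "h < Re z - r" "h < Re z + r" using z by (auto simp: r_def field_simps)
  have int: "integrable (Pi\<^sub>M A (\<lambda>_. lborel)) (\<lambda>w. norm (Phi A (?b (of_real x)) w))" if "h < x" for x
    by (intro integrable_norm integrable_Phi fin ne) (use pos[OF _ that] in \<open>auto simp: Re_scal_dim\<close>)
  have Re_le: "\<bar>Re y - Re z\<bar> \<le> r" if "y \<in> cball z r" for y
    using that abs_Re_le_cmod[of "y - z"] by (simp add: dist_norm norm_minus_commute)
  have "norm (Phi A (?b y) w) \<le> g w" if y: "y \<in> cball z r" for y w
  proof (cases "\<forall>i\<in>A. 0 < w i")
    case True
    define p where "p = (\<Sum>T\<in>subs A. m T * ln (sum w T))"
    define c where "c = (\<Sum>T\<in>subs A. q T * ln (sum w T)) - sum w A"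
    have "norm (Phi A (?b y) w) = exp (Re y * p + c)" for y
      using True by (simp add: norm_Phi p_def c_def algebra_simps sum.distrib sum_distrib_left)
    then show ?thesis
      using exp_affine_le[of "Re z - r" "Re y" "Re z + r" p c] Re_le[OF y] by (simp add: g_def)
  next
    case False
    then show ?thesis by (auto simp: norm_Phi g_def)
  qed
  moreover have "cball z r \<subseteq> {z. h < Re z}"
    using Re_le r by fastforce
  moreover have "integrable (Pi\<^sub>M A (\<lambda>_. lborel)) g"
    unfolding g_def by (rule Bochner_Integration.integrable_add[OF int[OF r(2)] int[OF r(3)]])
  ultimately show "\<exists>r g. 0 < r \<and> cball z r \<subseteq> {z. h < Re z} \<and> integrable (Pi\<^sub>M A (\<lambda>_. lborel)) g \<and>
      (\<forall>y\<in>cball z r. \<forall>w\<in>space (Pi\<^sub>M A (\<lambda>_. lborel)). norm (Phi A (?b y) w) \<le> g w)"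
    using r by blast
qed

section \<open>Continuation along affine exponents, one half plane after another\<close>

text \<open>Lets all terms of the relation, whose scaling exponents have moved by 0 or 1, be
  normalised by the same Gamma factors at the cost of a polynomial.\<close>

lemma prod_rGamma_shift:
  fixes c d :: "'j \<Rightarrow> complex" and e :: "'j \<Rightarrow> nat"
  assumes "finite J" "\<And>j. j \<in> J \<Longrightarrow> e j \<le> 1" "\<And>j. j \<in> J \<Longrightarrow> d j = c j + of_nat (e j)"
  shows "(\<Prod>j\<in>J. rGamma (c j)) = (\<Prod>j\<in>J. if e j = 0 then 1 else c j) * (\<Prod>j\<in>J. rGamma (d j))"
  unfolding prod.distrib[symmetric]
proof (rule prod.cong[OF refl])
  fix j assume j: "j \<in> J"
  then have "e j = 0 \<or> e j = 1" using assms(2)[OF j] by auto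
  then show "rGamma (c j) = (if e j = 0 then 1 else c j) * rGamma (d j)"
    using assms(3)[OF j] by (auto simp: rGamma_plus1)
qed

text \<open>The bound \<open>m_le\<close> makes every \<open>card S + sum m (subs S) * Re z\<close>
  positive for \<open>Re z > -1\<close>, as \<open>S\<close> is nonempty.\<close>

locale affine_family =
  fixes A :: "'i set" and m :: "'i set \<Rightarrow> nat"
  assumes fin: "finite A" and ne: "A \<noteq> {}"
    and m_le: "S \<in> subs A \<Longrightarrow> sum m (subs S) \<le> card S"
begin

text \<open>The slopes \<open>m\<close> stay fixed and the recursion moves only the integers
  \<open>q\<close>. Single values of \<open>q\<close> may become negative; only the sums over
  \<open>subs S\<close> are constrained.\<close>

definition expo :: "('i set \<Rightarrow> int) \<Rightarrow> complex \<Rightarrow> 'i set \<Rightarrow> complex" where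
  "expo q z T = of_nat (m T) * z + of_int (q T)"

lemma scal_dim_expo: "scal_dim (expo q z) S = of_nat (card S) + of_nat (sum m (subs S)) * z + of_int (sum q (subs S))"
  by (simp add: scal_dim_def expo_def sum.distrib sum_distrib_right)

text \<open>The slope at \<open>S\<close> is at most \<open>card A\<close>, so moving the edge from
  -1 to \<open>- M\<close> costs at most \<open>(M - 1) * card A\<close>. The case
  \<open>M = 1\<close>, \<open>N = 0\<close> is the original half plane.\<close>

lemma scal_dim_expo_pos:
  assumes "S \<in> subs A" "- real M < Re z" "sum q (subs S) \<ge> int N" "N \<ge> (M - 1) * card A" "M \<ge> 1"
  shows "0 < Re (scal_dim (expo q z) S)"
proof -
  have S: "S \<subseteq> A" "S \<noteq> {}" "finite S" using assms(1) fin by (auto simp: subs_def intro: finite_subset)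
  then have card: "0 < card S" "card S \<le> card A" using fin by (auto simp: card_gt_0_iff intro: card_mono)
  define mS where "mS = sum m (subs S)"
  have mS: "mS \<le> card S" using m_le[OF assms(1)] by (simp add: mS_def)
  have "real mS * (real M - 1) \<le> real (card A) * (real M - 1)"
    using mS card assms(5) by (intro mult_right_mono) auto
  also have "\<dots> \<le> real N"
    using assms(4,5) by (metis mult.commute of_nat_1 of_nat_diff of_nat_le_iff of_nat_mult)
  also have "\<dots> \<le> of_int (sum q (subs S))" using assms(3) by linarith
  finally have 1: "real mS * real M \<le> real mS + of_int (sum q (subs S))" by (simp add: algebra_simps)
  have "0 < real (card S) + real mS * Re z + of_int (sum q (subs S))"
  proof (cases "mS = 0")
    case True
    then show ?thesis using card 1 by simp
  next
    case False
    then have "real mS * (- real M) < real mS * Re z" using assms(2) by (intro mult_strict_left_mono) auto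
    then show ?thesis using 1 mS by simp
  qed
  then show ?thesis by (simp add: scal_dim_expo mS_def)
qed

text \<open>The induction is on the total amount by which the sums of the shifts \<open>q\<close> fall short of a bound beyond
  which the integral converges on the whole half plane.\<close>

lemma rGamma_Jint_extends:
  assumes M: "M \<ge> 1" and q: "\<And>S. S \<in> subs A \<Longrightarrow> 0 \<le> sum q (subs S)"
  shows "\<exists>E. E holomorphic_on {z. - real M < Re z} \<and>
     (\<forall>z. -1 < Re z \<longrightarrow> E z = Jint A (expo q z) * (\<Prod>S\<in>subs A. rGamma (scal_dim (expo q z) S)))"
  using q
proof (induction "\<Sum>S\<in>subs A. nat (int (M * card A) - sum q (subs S))" arbitrary: q rule: less_induct)
  case less
  note q = less.prems
  let ?N = "M * card A"
  let ?B = "\<lambda>q S. sum q (subs S) :: int"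
  let ?U = "{z. - real M < Re z}"
  show ?case
  proof (cases "\<forall>S\<in>subs A. int ?N \<le> ?B q S")
    case True
    have "(\<lambda>z. Jint A (\<lambda>T. of_real (real (m T)) * z + of_real (of_int (q T)))) holomorphic_on ?U"
    proof (rule holomorphic_Jint[OF fin ne])
      fix S x assume S: "S \<in> subs A" and x: "- real M < x"
      have "0 < Re (scal_dim (expo q (of_real x)) S)"
        using scal_dim_expo_pos[of S M "of_real x" ?N q] S x True M by auto
      then show "0 < scal_dim (\<lambda>T. real (m T) * x + of_int (q T)) S"
        by (simp add: Re_scal_dim expo_def)
    qed
    then have "(\<lambda>z. Jint A (expo q z)) holomorphic_on ?U"
      by (simp add: expo_def[abs_def])
    then have "(\<lambda>z. Jint A (expo q z) * (\<Prod>S\<in>subs A. rGamma (scal_dim (expo q z) S))) holomorphic_on ?U"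
      unfolding scal_dim_expo by (intro holomorphic_intros holomorphic_rGamma')
    then show ?thesis by blast
  next
    case False
    \<comment> \<open>The relation is applied at a set whose shift still falls short, so that every
      term on its right side has a smaller deficit.\<close>
    then obtain S where S: "S \<in> subs A" and BS: "?B q S < int ?N" by auto
    have SA: "S \<subseteq> A" "finite S" using S fin by (auto simp: subs_def intro: finite_subset)
    have fin_sub: "finite S'" if "S' \<in> subs A" for S'
      using that fin by (auto simp: subs_def intro: finite_subset)
    let ?R = "{T \<in> subs A. S \<inter> T \<noteq> {} \<and> \<not> T \<subseteq> S}"
    let ?q0 = "q(S := q S + 1)"
    let ?qT = "\<lambda>T. (q(T := q T - 1))(S \<inter> T := q (S \<inter> T) + 1)"
    let ?sd = "\<lambda>q z S. scal_dim (expo q z) S"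
    have upd: "?B (p(T := p T + d)) S' = ?B p S' + (if T \<in> subs S' then d else 0)" if "S' \<in> subs A" for p T d S'
      using scal_dim_upd[OF fin_sub[OF that], of p T d] by (simp add: scal_dim_def)
    \<comment> \<open>All terms of the relation fit this pattern: some scaling exponents rise by
      one, the one at \<open>S\<close> among them. The induction hypothesis for \<open>p\<close> is
      restated with a product of Gamma factors that does not depend on \<open>p\<close>, so the
      terms can be combined.\<close>
    have step: "\<exists>E. E holomorphic_on ?U \<and>
       (\<forall>z. -1 < Re z \<longrightarrow> E z = Jint A (expo p z) * (rGamma (?sd q z S + 1) * (\<Prod>S'\<in>subs A-{S}. rGamma (?sd q z S'))))"
      if p: "\<And>S'. S' \<in> subs A \<Longrightarrow> ?B p S' = ?B q S' + int (e S')" and e: "\<And>S'. e S' \<le> 1" and eS: "e S = 1" for p and e :: "'i set \<Rightarrow> nat"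
    proof -
      have "(\<Sum>S\<in>subs A. nat (int ?N - ?B p S)) < (\<Sum>S\<in>subs A. nat (int ?N - ?B q S))"
      proof (rule sum_strict_mono_ex1)
        show "\<exists>x\<in>subs A. nat (int ?N - ?B p x) < nat (int ?N - ?B q x)"
          using S BS p[OF S] eS by (intro bexI[of _ S]) auto
      qed (use fin p in auto)
      moreover have "0 \<le> ?B p S'" if "S' \<in> subs A" for S'
        using p[OF that] q[OF that] by simp
      ultimately obtain E where E: "E holomorphic_on ?U"
        and E_eq: "\<And>z. -1 < Re z \<Longrightarrow> E z = Jint A (expo p z) * (\<Prod>S\<in>subs A. rGamma (?sd p z S))"
        using less.hyps[of p] by blast
      define w where "w z = (\<Prod>S'\<in>subs A-{S}. if e S' = 0 then 1 else ?sd q z S')" for z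
      have sd: "?sd p z S' = ?sd q z S' + of_nat (e S')" if "S' \<in> subs A" for z S'
        using p[OF that] by (simp add: scal_dim_expo)
      have "w holomorphic_on ?U"
        unfolding w_def
      proof (intro holomorphic_on_prod)
        show "(\<lambda>z. if e S' = 0 then 1 else ?sd q z S') holomorphic_on ?U" for S'
          unfolding scal_dim_expo by (cases "e S' = 0") (auto intro!: holomorphic_intros)
      qed
      then have "(\<lambda>z. w z * E z) holomorphic_on ?U"
        using E by (intro holomorphic_intros)
      moreover have "w z * E z = Jint A (expo p z) * (rGamma (?sd q z S + 1) * (\<Prod>S'\<in>subs A-{S}. rGamma (?sd q z S')))"
        if z: "-1 < Re z" for z
      proof -
        have "(\<Prod>S'\<in>subs A-{S}. rGamma (?sd q z S')) = w z * (\<Prod>S'\<in>subs A-{S}. rGamma (?sd p z S'))"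
          unfolding w_def using fin e sd by (intro prod_rGamma_shift) auto
        moreover have "(\<Prod>S'\<in>subs A. rGamma (?sd p z S')) = rGamma (?sd q z S + 1) * (\<Prod>S'\<in>subs A-{S}. rGamma (?sd p z S'))"
          using fin S sd[OF S] eS by (simp add: prod.remove[of _ S])
        ultimately show ?thesis using E_eq[OF z] by simp
      qed
      ultimately show ?thesis by (intro exI[of _ "\<lambda>z. w z * E z"]) auto
    qed
    have "\<exists>E. E holomorphic_on ?U \<and>
       (\<forall>z. -1 < Re z \<longrightarrow> E z = Jint A (expo ?q0 z) * (rGamma (?sd q z S + 1) * (\<Prod>S'\<in>subs A-{S}. rGamma (?sd q z S'))))"
    proof (rule step[of _ "\<lambda>S'. if S \<in> subs S' then 1 else 0"])
      show "(if S \<in> subs S then 1 else 0) = (1::nat)" using S by (auto simp: subs_def)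
      show "?B ?q0 S' = ?B q S' + int (if S \<in> subs S' then 1 else 0)" if "S' \<in> subs A" for S'
        using upd[OF that, of q S 1] by (simp del: fun_upd_apply)
    qed auto
    then obtain E0 where E0: "E0 holomorphic_on ?U"
       "\<And>z. -1 < Re z \<Longrightarrow> E0 z = Jint A (expo ?q0 z) * (rGamma (?sd q z S + 1) * (\<Prod>S'\<in>subs A-{S}. rGamma (?sd q z S')))"
      by blast
    have "\<exists>E. E holomorphic_on ?U \<and>
       (\<forall>z. -1 < Re z \<longrightarrow> E z = Jint A (expo (?qT T) z) * (rGamma (?sd q z S + 1) * (\<Prod>S'\<in>subs A-{S}. rGamma (?sd q z S'))))"
      if T: "T \<in> ?R" for T
    \<comment> \<open>A set containing \<open>T\<close> also contains \<open>S \<inter> T\<close>,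
      and the changes -1 and +1 cancel. Sets containing only \<open>S \<inter> T\<close> gain one,
      and \<open>S\<close> is such a set.\<close>
    proof (rule step[of _ "\<lambda>S'. if S \<inter> T \<in> subs S' \<and> T \<notin> subs S' then 1 else 0"])
      have neq: "S \<inter> T \<noteq> T" using T by auto
      show "(if S \<inter> T \<in> subs S \<and> T \<notin> subs S then 1 else 0) = (1::nat)" using S T by (auto simp: subs_def)
      show "?B (?qT T) S' = ?B q S' + int (if S \<inter> T \<in> subs S' \<and> T \<notin> subs S' then 1 else 0)" if S': "S' \<in> subs A" for S'
      proof -
        have "T \<in> subs S' \<Longrightarrow> S \<inter> T \<in> subs S'" using T by (auto simp: subs_def)
        moreover have "(q(T := q T - 1)) (S \<inter> T) = q (S \<inter> T)" using neq by simp
        ultimately show ?thesis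
          using upd[OF S', of "q(T := q T - 1)" "S \<inter> T" 1] upd[OF S', of q T "-1"]
          by (simp del: fun_upd_apply split: if_splits)
      qed
    qed auto
    then have "\<forall>T\<in>?R. \<exists>E. E holomorphic_on ?U \<and>
       (\<forall>z. -1 < Re z \<longrightarrow> E z = Jint A (expo (?qT T) z) * (rGamma (?sd q z S + 1) * (\<Prod>S'\<in>subs A-{S}. rGamma (?sd q z S'))))"
      by (rule ballI)
    from bchoice[OF this] obtain ET where ET: "\<forall>T\<in>?R. ET T holomorphic_on ?U \<and>
       (\<forall>z. -1 < Re z \<longrightarrow> ET T z = Jint A (expo (?qT T) z) * (rGamma (?sd q z S + 1) * (\<Prod>S'\<in>subs A-{S}. rGamma (?sd q z S'))))"
      ..
    let ?E = "\<lambda>z. E0 z - (\<Sum>T\<in>?R. expo q z T * ET T z)"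
    have "?E holomorphic_on ?U"
      using E0(1) ET unfolding expo_def by (intro holomorphic_intros) auto
    moreover have "?E z = Jint A (expo q z) * (\<Prod>S\<in>subs A. rGamma (?sd q z S))" if z: "-1 < Re z" for z
    proof -
      define G where "G = rGamma (?sd q z S + 1) * (\<Prod>S'\<in>subs A-{S}. rGamma (?sd q z S'))"
      have pos: "0 < Re (?sd q z S')" if "S' \<in> subs A" for S'
        using scal_dim_expo_pos[OF that, of 1 z 0 q] z q[OF that] by simp
      have ex0: "expo ?q0 z = (expo q z)(S := expo q z S + 1)"
        by (auto simp: expo_def)
      have exT: "expo (?qT T) z = ((expo q z)(T := expo q z T - 1))(S \<inter> T := expo q z (S \<inter> T) + 1)" for T
        by (auto simp: expo_def)
      \<comment> \<open>Splitting off the factor at \<open>S\<close> releases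
        \<open>?sd q z S\<close>, precisely the left side of the relation; no division by it takes
        place.\<close>
      have "(\<Prod>S\<in>subs A. rGamma (?sd q z S)) = ?sd q z S * G"
        using fin S rGamma_plus1[of "?sd q z S"] by (simp add: G_def prod.remove[of _ S] mult.assoc)
      then have "Jint A (expo q z) * (\<Prod>S\<in>subs A. rGamma (?sd q z S)) = (?sd q z S * Jint A (expo q z)) * G"
        by simp
      also have "\<dots> = (Jint A (expo ?q0 z) - (\<Sum>T\<in>?R. expo q z T * Jint A (expo (?qT T) z))) * G"
        unfolding ex0 exT by (subst scal_dim_Jint[OF fin _ S]) (use pos in auto)
      also have "\<dots> = ?E z"
        using E0(2)[OF z] ET z by (simp add: G_def left_diff_distrib sum_distrib_right mult.assoc)
      finally show ?thesis ..
    qed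
    ultimately show ?thesis by blast
  qed
qed

text \<open>The extensions to the half planes all agree on \<open>Re z > -1\<close>, hence on their
  common domains by the identity theorem, and glue together.\<close>

lemma entire_extension:
  "\<exists>E. E holomorphic_on UNIV \<and>
     (\<forall>z. -1 < Re z \<longrightarrow> E z = Jint A (expo (\<lambda>_. 0) z) * (\<Prod>S\<in>subs A. rGamma (scal_dim (expo (\<lambda>_. 0) z) S)))"
proof -
  let ?f = "\<lambda>z. Jint A (expo (\<lambda>_. 0) z) * (\<Prod>S\<in>subs A. rGamma (scal_dim (expo (\<lambda>_. 0) z) S))"
  have "\<exists>E. E holomorphic_on {z. - real (Suc M) < Re z} \<and> (\<forall>z. -1 < Re z \<longrightarrow> E z = ?f z)" for M
    by (rule rGamma_Jint_extends) auto
  then obtain E where E: "\<And>M. E M holomorphic_on {z. - real (Suc M) < Re z}"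
    "\<And>M z. -1 < Re z \<Longrightarrow> E M z = ?f z"
    by metis
  have agree: "E M z = E N z" if "- real (Suc M) < Re z" "M \<le> N" for M N z
  proof (rule analytic_continuation_open[where s = "{z. -1 < Re z}" and s' = "{z. - real (Suc M) < Re z}" and f = "E M" and g = "E N"])
    show "E N holomorphic_on {z. - real (Suc M) < Re z}"
      using E(1)[of N] by (rule holomorphic_on_subset) (use that in auto)
    show "{z. -1 < Re z} \<noteq> {}" by (auto intro: exI[of _ 0])
    show "E M y = E N y" if "y \<in> {z. -1 < Re z}" for y using that E(2) by simp
  qed (use E(1) that in \<open>auto simp: open_halfspace_Re_gt convex_halfspace_Re_gt convex_connected\<close>)
  \<comment> \<open>Any index whose half plane contains \<open>z\<close> would do; this one does
    because \<open>- \<bar>Re z\<bar> - 1 < Re z\<close>.\<close>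
  define F where "F z = E (nat \<lceil>\<bar>Re z\<bar>\<rceil>) z" for z
  have F_eq: "F z = E M z" if "- real (Suc M) < Re z" for z M
  proof -
    have *: "- real (Suc (nat \<lceil>\<bar>Re z\<bar>\<rceil>)) < Re z" by linarith
    show ?thesis
      unfolding F_def using agree[OF *, of M] agree[OF that, of "nat \<lceil>\<bar>Re z\<bar>\<rceil>"]
      by (metis nle_le)
  qed
  have "F holomorphic_on (\<Union>M. {z. - real (Suc M) < Re z})"
  proof (rule holomorphic_on_UN_open)
    show "F holomorphic_on {z. - real (Suc M) < Re z}" for M
      using E(1)[of M] by (rule holomorphic_transform) (simp add: F_eq)
  qed (simp add: open_halfspace_Re_gt)
  moreover have "(\<Union>M. {z. - real (Suc M) < Re z}) = UNIV"
  proof -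
    have "- real (Suc (nat \<lceil>\<bar>Re z\<bar>\<rceil>)) < Re z" for z by linarith
    then show ?thesis by blast
  qed
  ultimately have "F holomorphic_on UNIV" by simp
  moreover have "F z = ?f z" if "-1 < Re z" for z
    using F_eq[of 0 z] E(2)[OF that] that by simp
  ultimately show ?thesis by blast
qed

end

section \<open>Partial sums and the Laplace transform of a homogeneous function\<close>

text \<open>Passage from increments back to points, combined with a dilation by \<open>r\<close>:
  \<open>r = 1\<close> is the change of variables, general \<open>r\<close> gives homogeneity. The
  restriction keeps the result extensional.\<close>

definition psum :: "real \<Rightarrow> nat \<Rightarrow> (nat \<Rightarrow> real) \<Rightarrow> nat \<Rightarrow> real" where
  "psum r n w = (\<lambda>i\<in>{1..n}. r * sum w {1..i})"

lemma measurable_psum [measurable]: "psum r n \<in> measurable (lborel_vec n) (lborel_vec n)"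
  unfolding psum_def
proof (rule measurable_restrict)
  fix i assume "i \<in> {1..n}"
  then have "(\<lambda>w. sum w {1..i} :: real) \<in> borel_measurable (lborel_vec n)"
    by (intro measurable_sum_component) auto
  then show "(\<lambda>w. r * sum w {1..i}) \<in> measurable (lborel_vec n) lborel"
    by simp
qed

text \<open>The map is triangular, and affine with slope \<open>r\<close> in its last variable, so
  each dimension contributes one factor \<open>r\<close>. Nonnegative integrals allow Tonelli
  without integrability conditions.\<close>

lemma nn_integral_psum:
  assumes "r > 0" "f \<in> borel_measurable (lborel_vec n)"
  shows "(\<integral>\<^sup>+s. f s \<partial>lborel_vec n) = ennreal (r ^ n) * (\<integral>\<^sup>+w. f (psum r n w) \<partial>lborel_vec n)"
  using assms(2)
proof (induction n arbitrary: f)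
  case 0
  interpret product_sigma_finite "\<lambda>_. lborel :: real measure"
    by (rule product_sigma_finite_lborel)
  have empty: "integral\<^sup>N (Pi\<^sub>M {} (\<lambda>_. lborel)) g = g (\<lambda>k. undefined)" for g :: "(nat \<Rightarrow> real) \<Rightarrow> ennreal"
    by (rule nn_integral_empty) simp
  have "{1..0::nat} = {}" by simp
  then show ?case by (simp only: empty) (simp add: psum_def restrict_def)
next
  case (Suc n)
  interpret product_sigma_finite "\<lambda>_. lborel :: real measure"
    by (rule product_sigma_finite_lborel)
  have ins: "{1..Suc n} = insert (Suc n) {1..n}" by auto
  note f = Suc.prems[unfolded ins]
  have add_dim: "(\<lambda>(v, y). f (v(Suc n := y))) \<in> borel_measurable (lborel_vec n \<Otimes>\<^sub>M lborel)"
    using measurable_compose[OF measurable_add_dim[of "Suc n" "{1..n}" "\<lambda>_. lborel"] f]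
    by (simp only: case_prod_unfold)
  define g where "g v = (\<integral>\<^sup>+y. f (v(Suc n := y)) \<partial>lborel)" for v
  have g: "g \<in> borel_measurable (lborel_vec n)"
    unfolding g_def by (rule lborel.borel_measurable_nn_integral[OF add_dim])
  have slice: "(\<integral>\<^sup>+y. f (psum r (Suc n) (w(Suc n := y))) \<partial>lborel) * ennreal r = g (psum r n w)"
    if w: "w \<in> space (lborel_vec n)" for w
  proof -
    have eq: "psum r (Suc n) (w(Suc n := y)) = (psum r n w)(Suc n := r * sum w {1..n} + r * y)" for y
    proof
      fix i
      have "sum (w(Suc n := y)) {1..j} = sum w {1..j}" if "j \<le> n" for j
        using that by (intro sum.cong) auto
      then show "psum r (Suc n) (w(Suc n := y)) i = ((psum r n w)(Suc n := r * sum w {1..n} + r * y)) i"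
        by (cases "i = Suc n") (auto simp: psum_def ins distrib_left restrict_def le_Suc_eq sum.atLeast1_atMost_eq)
    qed
    have pw: "psum r n w \<in> space (lborel_vec n)" using measurable_space[OF measurable_psum w] .
    have "(\<lambda>y. f ((psum r n w)(Suc n := y))) \<in> borel_measurable lborel"
      by (rule measurable_compose[OF measurable_component_update[OF pw] f]) auto
    then have "(\<lambda>y. f ((psum r n w)(Suc n := y))) \<in> borel_measurable borel" by simp
    from nn_integral_real_affine[OF this, of r "r * sum w {1..n}"] assms(1)
    show ?thesis by (simp add: g_def eq mult.commute)
  qed
  have meas: "(\<lambda>w. f (psum r (Suc n) w)) \<in> borel_measurable (Pi\<^sub>M (insert (Suc n) {1..n}) (\<lambda>_. lborel))"
    using measurable_compose[OF measurable_psum[of r "Suc n"] Suc.prems] unfolding ins .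
  have "(\<integral>\<^sup>+s. f s \<partial>lborel_vec (Suc n)) = (\<integral>\<^sup>+v. g v \<partial>lborel_vec n)"
    unfolding ins g_def using f by (subst product_nn_integral_insert) auto
  also have "\<dots> = ennreal (r ^ n) * (\<integral>\<^sup>+w. g (psum r n w) \<partial>lborel_vec n)"
    by (rule Suc.IH[OF g])
  also have "(\<integral>\<^sup>+w. g (psum r n w) \<partial>lborel_vec n) =
     (\<integral>\<^sup>+w. (\<integral>\<^sup>+y. f (psum r (Suc n) (w(Suc n := y))) \<partial>lborel) * ennreal r \<partial>lborel_vec n)"
    by (rule nn_integral_cong) (simp add: slice)
  also have "\<dots> = (\<integral>\<^sup>+w. (\<integral>\<^sup>+y. f (psum r (Suc n) (w(Suc n := y))) \<partial>lborel) \<partial>lborel_vec n) * ennreal r"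
  proof (rule nn_integral_multc)
    show "(\<lambda>w. \<integral>\<^sup>+y. f (psum r (Suc n) (w(Suc n := y))) \<partial>lborel) \<in> borel_measurable (lborel_vec n)"
      using measurable_compose[OF measurable_add_dim[of "Suc n" "{1..n}" "\<lambda>_. lborel"] meas]
      by (intro lborel.borel_measurable_nn_integral) (simp only: case_prod_unfold)
  qed
  also have "(\<integral>\<^sup>+w. (\<integral>\<^sup>+y. f (psum r (Suc n) (w(Suc n := y))) \<partial>lborel) \<partial>lborel_vec n) =
      (\<integral>\<^sup>+w. f (psum r (Suc n) w) \<partial>lborel_vec (Suc n))"
    unfolding ins using meas by (subst product_nn_integral_insert) auto
  finally show ?case
    using assms(1) by (simp add: ennreal_mult mult_ac)
qed

text \<open>As an identity of measures, the substitution rule transfers to complex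
  integrals.\<close>

lemma density_distr_psum:
  assumes "r > 0"
  shows "density (distr (lborel_vec n) (lborel_vec n) (psum r n)) (\<lambda>_. ennreal (r ^ n)) = lborel_vec n"
proof (rule measure_eqI)
  fix X assume "X \<in> sets (density (distr (lborel_vec n) (lborel_vec n) (psum r n)) (\<lambda>_. ennreal (r ^ n)))"
  then have X[measurable]: "X \<in> sets (lborel_vec n)" by simp
  have "emeasure (lborel_vec n) X = (\<integral>\<^sup>+s. indicator X s \<partial>lborel_vec n)"
    by (rule nn_integral_indicator[OF X, symmetric])
  also have "\<dots> = ennreal (r ^ n) * (\<integral>\<^sup>+w. indicator X (psum r n w) \<partial>lborel_vec n)"
    by (intro nn_integral_psum[OF assms] borel_measurable_indicator X)
  also have "(\<integral>\<^sup>+w. indicator X (psum r n w) \<partial>lborel_vec n) =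
      (\<integral>\<^sup>+s. indicator X s \<partial>distr (lborel_vec n) (lborel_vec n) (psum r n))"
    by (rule nn_integral_distr[OF measurable_psum, symmetric]) (intro borel_measurable_indicator, subst sets_distr, rule X)
  also have "\<dots> = emeasure (distr (lborel_vec n) (lborel_vec n) (psum r n)) X"
    by (rule nn_integral_indicator) (subst sets_distr, rule X)
  also have "ennreal (r ^ n) * \<dots> =
      emeasure (density (distr (lborel_vec n) (lborel_vec n) (psum r n)) (\<lambda>_. ennreal (r ^ n))) X"
    by (rule emeasure_density_const[symmetric]) (subst sets_distr, rule X)
  finally show "emeasure (density (distr (lborel_vec n) (lborel_vec n) (psum r n)) (\<lambda>_. ennreal (r ^ n))) X
      = emeasure (lborel_vec n) X" ..
qed simp

lemma integrable_psum_iff: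
  fixes f :: "(nat \<Rightarrow> real) \<Rightarrow> complex"
  assumes [measurable]: "f \<in> borel_measurable (lborel_vec n)"
  shows "integrable (lborel_vec n) f \<longleftrightarrow> integrable (lborel_vec n) (\<lambda>w. f (psum 1 n w))"
proof -
  have "distr (lborel_vec n) (lborel_vec n) (psum 1 n) = lborel_vec n"
    using density_distr_psum[of 1 n] by (simp add: density_1)
  then have "integrable (lborel_vec n) f \<longleftrightarrow> integrable (distr (lborel_vec n) (lborel_vec n) (psum 1 n)) f"
    by simp
  also have "\<dots> \<longleftrightarrow> integrable (lborel_vec n) (\<lambda>w. f (psum 1 n w))"
    by (rule integrable_distr_eq[OF measurable_psum assms])
  finally show ?thesis .
qed

lemma integral_psum:
  fixes f :: "(nat \<Rightarrow> real) \<Rightarrow> complex"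
  assumes r: "r > 0" and f: "f \<in> borel_measurable (lborel_vec n)"
  shows "(LINT s|lborel_vec n. f s) = of_real (r ^ n) * (LINT w|lborel_vec n. f (psum r n w))"
proof -
  have "(LINT s|lborel_vec n. f s) =
    (LINT s|density (distr (lborel_vec n) (lborel_vec n) (psum r n)) (\<lambda>_. ennreal (r ^ n)). f s)"
    by (simp only: density_distr_psum[OF r])
  also have "\<dots> = (LINT s|distr (lborel_vec n) (lborel_vec n) (psum r n). (r ^ n) *\<^sub>R f s)"
    by (rule integral_density) (use r f in auto)
  also have "\<dots> = (LINT w|lborel_vec n. (r ^ n) *\<^sub>R f (psum r n w))"
    by (rule integral_distr[OF measurable_psum]) (intro borel_measurable_scaleR borel_measurable_const f)
  finally show ?thesis by (simp add: scaleR_conv_of_real)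
qed

section \<open>The Laplace weight as a superposition of sharp cutoffs\<close>

lemma has_bochner_integral_exp_tail:
  "has_bochner_integral lborel (\<lambda>t. indicator {x<..} t * exp (- t)) (exp (- x :: real))"
proof -
  have "has_bochner_integral lborel (\<lambda>t. indicator {x..} t * exp (- t)) (exp (- x))"
  proof (rule has_bochner_integral_nn_integral)
    have "((\<lambda>t. exp (- 1 * t)) has_integral exp (- 1 * x) / 1) {x..}"
      by (rule has_integral_exp_minus_to_infinity) simp
    then have "((\<lambda>t. exp (- t)) has_integral exp (- x)) {x..}" by simp
    from nn_integral_has_integral_lebesgue[OF _ this]
    show "(\<integral>\<^sup>+t. ennreal (indicator {x..} t * exp (- t)) \<partial>lborel) = ennreal (exp (- x))" by simp
  qed auto
  also have "?this \<longleftrightarrow> ?thesis"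
    using AE_lborel_singleton[of x]
    by (intro has_bochner_integral_cong_AE) (auto elim!: eventually_mono simp: indicator_def)
  finally show ?thesis .
qed

lemma LINT_Gamma:
  assumes "Re c > -1"
  shows "(LINT t|lborel. indicator {0<..} t *\<^sub>R (of_real t powr c * of_real (exp (- t)))) = Gamma (c + 1)"
proof -
  let ?f = "\<lambda>t. complex_of_real t powr (c + 1 - 1) / of_real (exp t)"
  have "?f absolutely_integrable_on {0<..}"
    by (rule absolutely_integrable_Gamma_integral') (use assms in auto)
  then have "(LINT t:{0<..}|lebesgue. ?f t) = integral {0<..} ?f"
    by (rule set_lebesgue_integral_eq_integral(2))
  also have "\<dots> = Gamma (c + 1)"
    by (rule integral_unique[OF Gamma_integral_complex']) (use assms in auto)
  finally have "(LINT t|lebesgue. indicator {0<..} t *\<^sub>R (of_real t powr c * of_real (exp (- t)))) = Gamma (c + 1)"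
    by (simp add: set_lebesgue_integral_def exp_minus divide_inverse)
  then show ?thesis
    by (subst (asm) integral_completion) auto
qed

text \<open>Write \<open>exp (-L)\<close> as the integral of \<open>exp (-t)\<close> over
  \<open>t > L\<close> and exchange the integrals. The inner one, over \<open>L < t\<close>, is
  \<open>t powr c * V\<close> by \<open>hom\<close>, and the outer one is a Gamma integral. Here
  \<open>c\<close> already includes the degree of the volume.\<close>

lemma laplace_homogeneous:
  fixes W :: "('i \<Rightarrow> real) \<Rightarrow> complex" and A :: "'i set"
  defines "M \<equiv> Pi\<^sub>M A (\<lambda>_. lborel :: real measure)"
  assumes fin: "finite A" and W[measurable]: "W \<in> borel_measurable M"
    and int: "integrable M (\<lambda>w. W w * of_real (exp (- sum w A)))"
    and supp: "\<And>w. W w \<noteq> 0 \<Longrightarrow> 0 < sum w A"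
    and hom: "\<And>r. 0 < r \<Longrightarrow> (LINT w|M. indicator {w. sum w A < r} w *\<^sub>R W w) = of_real r powr c * V"
    and c: "Re c > -1"
  shows "(LINT w|M. W w * of_real (exp (- sum w A))) = Gamma (c + 1) * V"
proof -
  interpret product_sigma_finite "\<lambda>_. lborel :: real measure"
    by (rule product_sigma_finite_lborel)
  interpret M: sigma_finite_measure M unfolding M_def using fin by (rule sigma_finite)
  interpret pair_sigma_finite M lborel ..
  have [measurable]: "(\<lambda>w. sum w A) \<in> borel_measurable M"
    unfolding M_def by (rule measurable_sum_component) simp
  define h where "h w t = (indicator {sum w A<..} t * exp (- t)) *\<^sub>R W w" for w t
  have ind: "indicator {sum w A<..} t = (if sum w A < t then 1 else 0 :: real)" for w t
    by (simp add: indicator_def)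
  have h_meas: "case_prod h \<in> borel_measurable (M \<Otimes>\<^sub>M lborel)"
    unfolding h_def ind case_prod_unfold by measurable
  have tail: "has_bochner_integral lborel (\<lambda>t. indicator {sum w A<..} t * exp (- t)) (exp (- sum w A))" for w :: "'i \<Rightarrow> real"
    by (rule has_bochner_integral_exp_tail)
  have inner: "(LINT t|lborel. h w t) = W w * of_real (exp (- sum w A))" for w
    unfolding h_def using tail[of w]
    by (subst integral_scaleR_left) (auto simp: has_bochner_integral_iff scaleR_conv_of_real mult.commute)
  \<comment> \<open>Integrating the absolute values over \<open>t\<close> gives back the norm of the
    original integrand, so \<open>int\<close> supplies the integrability for Fubini.\<close>
  have inner_norm: "(LINT t|lborel. norm (h w t)) = norm (W w * of_real (exp (- sum w A)))" for w
  proof -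
    have "(LINT t|lborel. norm (h w t)) = (LINT t|lborel. (indicator {sum w A<..} t * exp (- t)) * norm (W w))"
      unfolding h_def by (intro Bochner_Integration.integral_cong) auto
    also have "\<dots> = exp (- sum w A) * norm (W w)"
      using tail[of w] by (simp add: has_bochner_integral_iff)
    finally show ?thesis by (simp add: norm_mult mult.commute)
  qed
  have h_int: "integrable (M \<Otimes>\<^sub>M lborel) (case_prod h)"
  proof (rule Fubini_integrable[OF h_meas])
    show "integrable M (\<lambda>w. LINT t|lborel. norm (case (w, t) of (w, t) \<Rightarrow> h w t))"
      using integrable_norm[OF int] by (simp add: inner_norm)
    show "AE w in M. integrable lborel (\<lambda>t. case (w, t) of (w, t) \<Rightarrow> h w t)"
      unfolding h_def prod.case using tail
      by (intro AE_I2 integrable_scaleR_left) (simp add: has_bochner_integral_iff)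
  qed
  have "(LINT w|M. W w * of_real (exp (- sum w A))) = (LINT w|M. LINT t|lborel. h w t)"
    by (simp add: inner)
  also have "\<dots> = (LINT t|lborel. LINT w|M. h w t)"
    using Fubini_integral[OF h_int] by simp
  also have "\<dots> = (LINT t|lborel. (indicator {0<..} t *\<^sub>R (of_real t powr c * of_real (exp (- t)))) * V)"
  proof (rule Bochner_Integration.integral_cong[OF refl])
    fix t
    show "(LINT w|M. h w t) = (indicator {0<..} t *\<^sub>R (of_real t powr c * of_real (exp (- t)))) * V"
    proof (cases "t > 0")
      case True
      have "(LINT w|M. h w t) = (LINT w|M. exp (- t) *\<^sub>R (indicator {w. sum w A < t} w *\<^sub>R W w))"
        by (intro Bochner_Integration.integral_cong) (auto simp: h_def indicator_def)
      also have "\<dots> = exp (- t) *\<^sub>R (of_real t powr c * V)"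
        unfolding hom[OF True, symmetric] by (rule integral_scaleR_right)
      finally show ?thesis using True by (simp add: scaleR_conv_of_real)
    next
      case False
      then have "h w t = 0" for w using supp[of w]
        by (cases "W w = 0") (auto simp: h_def indicator_def)
      then show ?thesis using False by simp
    qed
  qed
  also have "\<dots> = Gamma (c + 1) * V"
    unfolding LINT_Gamma[OF c, symmetric] by (rule integral_mult_left_zero)
  finally show ?thesis .
qed

section \<open>The integral of a pair partition\<close>

locale pairing =
  fixes k :: nat and P :: "nat set set"
  assumes k: "k \<ge> 1" and P: "pair_partition k P"
begin

abbreviation N where "N \<equiv> {1..2*k}"

lemma finite_P: "finite P"
proof (rule ccontr)
  assume "infinite P"
  then have "card P = 0" by simp
  then show False using P k by (simp add: pair_partition_def)
qed

lemma block:
  assumes "B \<in> P"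
  shows "1 \<le> Min B" "Min B < Max B" "Max B \<le> 2*k" "B = {Min B, Max B}" "finite B"
proof -
  have "card B = 2" and sub: "B \<subseteq> N"
    using P assms by (auto simp: pair_partition_def partition_on_def)
  then obtain a b where B: "B = {a, b}" "a < b"
    by (metis card_2_iff insert_commute linorder_neqE_nat)
  then show "1 \<le> Min B" "Min B < Max B" "Max B \<le> 2*k" "B = {Min B, Max B}" "finite B"
    using sub by (auto simp: min_def max_def)
qed

lemma inj_Max: "inj_on Max P"
proof (rule inj_onI)
  fix B C assume BC: "B \<in> P" "C \<in> P" "Max B = Max C"
  then have "Max B \<in> B \<inter> C" using block(4)[of B] block(4)[of C] by (metis IntI insertCI)
  then show "B = C" using P BC unfolding pair_partition_def partition_on_def disjoint_def by blast
qed

lemma Max_pair_interval: "B \<in> P \<Longrightarrow> Max (pair_interval B) = Max B"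
  unfolding pair_interval_def using block(2)[of B] by (intro Max_eqI) auto

text \<open>Lets products over blocks be rewritten over intervals, which is also what
  \<open>bracket\<close> counts.\<close>

lemma inj_pair_interval: "inj_on pair_interval P"
proof (rule inj_onI)
  fix B C assume BC: "B \<in> P" "C \<in> P" "pair_interval B = pair_interval C"
  then have "Max B = Max C" using Max_pair_interval[of B] Max_pair_interval[of C] by simp
  then show "B = C" using inj_onD[OF inj_Max] BC by blast
qed

definition m :: "nat set \<Rightarrow> nat" where
  "m T = (if T \<in> pair_intervals P then 1 else 0)"

lemma pair_intervals_subs: "pair_intervals P \<subseteq> subs N"
proof
  fix T assume "T \<in> pair_intervals P"
  then obtain B where "B \<in> P" "T = pair_interval B" by (auto simp: pair_intervals_def)
  then show "T \<in> subs N" using block[of B] by (auto simp: subs_def pair_interval_def)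
qed

lemma sum_m:
  assumes "S \<in> subs N"
  shows "sum m (subs S) = bracket S P"
proof -
  have "finite S" using assms by (auto simp: subs_def intro: finite_subset)
  then have "sum m (subs S) = card (subs S \<inter> pair_intervals P)"
    by (simp add: m_def sum.If_cases)
  also have "subs S \<inter> pair_intervals P = {J. J \<subseteq> S \<and> J \<in> pair_intervals P}"
    using pair_intervals_subs by (auto simp: subs_def)
  finally show ?thesis by (simp add: bracket_def)
qed

text \<open>An interval inside \<open>S\<close> is determined by its right end, a point of
  \<open>S\<close>, because the blocks are disjoint. With \<open>z = 2*H - 2\<close>, this is why
  convergence holds for \<open>Re z > -1\<close>, that is, \<open>Re H > 1/2\<close>.\<close>

lemma bracket_le_card:
  assumes "S \<in> subs N"
  shows "bracket S P \<le> card S"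
  unfolding bracket_def
proof (rule card_inj_on_le)
  have "finite S" using assms by (auto simp: subs_def intro: finite_subset)
  then show "finite S" .
  show "inj_on Max {J. J \<subseteq> S \<and> J \<in> pair_intervals P}"
  proof (rule inj_onI)
    fix I J
    assume IJ: "I \<in> {J. J \<subseteq> S \<and> J \<in> pair_intervals P}" "J \<in> {J. J \<subseteq> S \<and> J \<in> pair_intervals P}" "Max I = Max J"
    then obtain B C where BC: "B \<in> P" "I = pair_interval B" "C \<in> P" "J = pair_interval C"
      by (auto simp: pair_intervals_def)
    then have "Max B = Max C" using IJ(3) by (simp only: Max_pair_interval)
    then show "I = J" using inj_onD[OF inj_Max] BC by blast
  qed
  show "Max ` {J. J \<subseteq> S \<and> J \<in> pair_intervals P} \<subseteq> S"
  proof clarify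
    fix J assume "J \<subseteq> S" "J \<in> pair_intervals P"
    moreover then have "J \<noteq> {}" "finite J"
      using pair_intervals_subs by (auto simp: subs_def intro: finite_subset)
    ultimately show "Max J \<in> S" using Max_in by blast
  qed
qed

sublocale affine_family N m
proof
  show "sum m (subs S) \<le> card S" if "S \<in> subs N" for S
    using bracket_le_card[OF that] by (simp only: sum_m[OF that])
qed (use k in auto)

section \<open>The hypergeometric integrand in increments\<close>

definition W :: "complex \<Rightarrow> (nat \<Rightarrow> real) \<Rightarrow> complex" where
  "W z w = (if \<forall>i\<in>N. 0 < w i then exp (\<Sum>T\<in>subs N. expo (\<lambda>_. 0) z T * of_real (ln (sum w T))) else 0)"

lemma Phi_W: "Phi N (expo (\<lambda>_. 0) z) w = W z w * of_real (exp (- sum w N))"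
proof -
  have eq: "exp (X - of_real Y) = exp X * of_real (exp (- Y))" for X :: complex and Y :: real
  proof -
    have "X - of_real Y = X + of_real (- Y)" by simp
    then show ?thesis by (simp only: exp_add exp_of_real)
  qed
  show ?thesis
  proof (cases "\<forall>i\<in>N. 0 < w i")
    case True
    show ?thesis unfolding Phi_def W_def if_P[OF True] by (rule eq)
  next
    case False
    show ?thesis unfolding Phi_def W_def if_not_P[OF False] by simp
  qed
qed

lemma measurable_W: "W z \<in> borel_measurable (lborel_vec (2*k))"
proof -
  have "(\<lambda>w. sum w N :: real) \<in> borel_measurable (lborel_vec (2*k))"
    by (rule measurable_sum_component) simp
  then have "(\<lambda>w. Phi N (expo (\<lambda>_. 0) z) w * of_real (exp (sum w N))) \<in> borel_measurable (lborel_vec (2*k))"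
    using measurable_Phi[OF fin, of "expo (\<lambda>_. 0) z"] by measurable
  moreover have eq: "Phi N (expo (\<lambda>_. 0) z) w * of_real (exp (sum w N)) = W z w" for w
    unfolding Phi_W mult.assoc of_real_mult[symmetric] by (simp add: exp_minus)
  ultimately show ?thesis unfolding eq by simp
qed

lemma integrable_Phi_expo:
  assumes "-1 < Re z"
  shows "integrable (lborel_vec (2*k)) (Phi N (expo (\<lambda>_. 0) z))"
proof (rule integrable_Phi[OF fin ne])
  show "0 < Re (scal_dim (expo (\<lambda>_. 0) z) S)" if "S \<in> subs N" for S
    using scal_dim_expo_pos[OF that, of 1 z 0 "\<lambda>_. 0"] assms by simp
qed

definition cone :: "(nat \<Rightarrow> real) set" where
  "cone = {s. 0 < s 1 \<and> (\<forall>i\<in>{1..<2*k}. s i < s (i + 1))}"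

lemma psum_in_cone_iff:
  assumes "r > 0"
  shows "psum r (2*k) w \<in> cone \<longleftrightarrow> (\<forall>i\<in>N. 0 < w i)"
proof -
  have "psum r (2*k) w 1 = r * w 1" using k by (simp add: psum_def)
  moreover have "psum r (2*k) w (i + 1) = psum r (2*k) w i + r * w (i + 1)" if "i \<in> {1..<2*k}" for i
    using that by (simp add: psum_def distrib_left)
  ultimately have "psum r (2*k) w \<in> cone \<longleftrightarrow> 0 < w 1 \<and> (\<forall>i\<in>{1..<2*k}. 0 < w (i + 1))"
    using assms by (simp add: cone_def zero_less_mult_iff)
  also have "\<dots> \<longleftrightarrow> (\<forall>i\<in>N. 0 < w i)"
  proof
    assume *: "0 < w 1 \<and> (\<forall>i\<in>{1..<2*k}. 0 < w (i + 1))"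
    show "\<forall>i\<in>N. 0 < w i"
    proof
      fix i assume "i \<in> N"
      show "0 < w i"
      proof (cases "i = 1")
        case False
        then have "i - 1 \<in> {1..<2*k}" "i - 1 + 1 = i" using \<open>i \<in> N\<close> by auto
        then show ?thesis using * by metis
      qed (use * in simp)
    qed
  qed (use k in auto)
  finally show ?thesis .
qed

text \<open>The difference of the points at \<open>Max B\<close> and \<open>Min B\<close> is the sum
  of the increments from \<open>Min B + 1\<close> to \<open>Max B\<close>, whence the interval. Each
  of the \<open>k\<close> blocks contributes one power of \<open>r\<close>.\<close>

lemma hyp_integrand_psum:
  assumes r: "r > 0" and w: "\<forall>i\<in>N. 0 < w i"
  shows "hyp_integrand P H (psum r (2*k) w) = of_real r powr (of_nat k * (2*H - 2)) * W (2*H - 2) w"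
proof -
  let ?z = "2*H - 2"
  have L: "sum w T > 0" if "T \<in> pair_intervals P" for T
    using that pair_intervals_subs w by (intro ratio_bounds(3)[OF fin]) auto
  have fac: "complex_of_real \<bar>psum r (2*k) w (Min B) - psum r (2*k) w (Max B)\<bar> powr ?z =
      of_real r powr ?z * exp (?z * of_real (ln (sum w (pair_interval B))))" if B: "B \<in> P" for B
  proof -
    note b = block[OF B]
    have "{1..Max B} = {1..Min B} \<union> pair_interval B" "{1..Min B} \<inter> pair_interval B = {}"
      using b by (auto simp: pair_interval_def)
    then have "sum w {1..Max B} = sum w {1..Min B} + sum w (pair_interval B)"
      by (simp add: sum.union_disjoint pair_interval_def)
    then have "psum r (2*k) w (Max B) - psum r (2*k) w (Min B) = r * sum w (pair_interval B)"
      using b by (simp add: psum_def distrib_left)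
    moreover have "sum w (pair_interval B) > 0" using L B by (auto simp: pair_intervals_def)
    ultimately have "\<bar>psum r (2*k) w (Min B) - psum r (2*k) w (Max B)\<bar> = r * sum w (pair_interval B)"
      and "sum w (pair_interval B) > 0"
      using r by (auto simp: abs_minus_commute)
    then show ?thesis using r
      by (simp add: powr_def Ln_of_real ln_mult exp_add[symmetric] algebra_simps del: of_real_sum of_real_mult)
  qed
  have "hyp_integrand P H (psum r (2*k) w) =
      (\<Prod>B\<in>P. of_real r powr ?z * exp (?z * of_real (ln (sum w (pair_interval B)))))"
    unfolding hyp_integrand_def by (intro prod.cong refl fac)
  also have "\<dots> = (of_real r powr ?z) ^ k * (\<Prod>B\<in>P. exp (?z * of_real (ln (sum w (pair_interval B)))))"
    using P by (simp add: prod.distrib pair_partition_def)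
  also have "(of_real r powr ?z) ^ k = of_real r powr (of_nat k * ?z)"
    using r by (simp add: powr_def mult.assoc flip: exp_of_nat_mult)
  also have "(\<Prod>B\<in>P. exp (?z * of_real (ln (sum w (pair_interval B))))) =
      exp (\<Sum>T\<in>pair_intervals P. ?z * of_real (ln (sum w T)))"
    unfolding pair_intervals_def using finite_P inj_pair_interval
    by (simp add: exp_sum sum.reindex del: of_real_sum)
  also have "(\<Sum>T\<in>pair_intervals P. ?z * of_real (ln (sum w T))) =
      (\<Sum>T\<in>subs N. expo (\<lambda>_. 0) ?z T * of_real (ln (sum w T)))"
    using pair_intervals_subs fin by (intro sum.mono_neutral_cong_left) (auto simp: expo_def m_def)
  finally show ?thesis using w by (simp add: W_def)
qed

lemma measurable_hyp_integrand: "hyp_integrand P H \<in> borel_measurable (lborel_vec (2*k))"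
proof -
  have "(\<lambda>s. s i) \<in> borel_measurable (lborel_vec (2*k))" if "i \<in> N" for i
    using measurable_component_singleton[OF that, of "\<lambda>_. lborel"] by simp
  then have diff: "(\<lambda>s. s (Min B) - s (Max B)) \<in> borel_measurable (lborel_vec (2*k))" if "B \<in> P" for B
    using block[OF that] by (intro borel_measurable_diff) auto
  \<comment> \<open>The value at \<open>t = 0\<close> matches the convention
    \<open>0 powr a = 0\<close>.\<close>
  define g where "g t = (if t = 0 then 0 else exp ((2*H - 2) * of_real (ln \<bar>t\<bar>)))" for t :: real
  have "g \<in> borel_measurable borel" unfolding g_def by measurable
  then have "(\<lambda>s. \<Prod>B\<in>P. g (s (Min B) - s (Max B))) \<in> borel_measurable (lborel_vec (2*k))"
    by (intro borel_measurable_prod measurable_compose[OF diff])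
  moreover have "complex_of_real \<bar>t\<bar> powr (2*H - 2) = g t" for t
    by (simp add: g_def powr_def Ln_of_real)
  ultimately show ?thesis unfolding hyp_integrand_def[abs_def] by simp
qed

text \<open>The integrand on the simplex of side \<open>r\<close>, set to zero elsewhere; a variable
  side is what the scaling argument needs.\<close>

definition Psi :: "complex \<Rightarrow> real \<Rightarrow> (nat \<Rightarrow> real) \<Rightarrow> complex" where
  "Psi H r s = (if s \<in> cone \<and> s (2*k) < r then hyp_integrand P H s else 0)"

lemma measurable_Psi: "Psi H r \<in> borel_measurable (lborel_vec (2*k))"
proof -
  have comp: "(\<lambda>s. s i) \<in> borel_measurable (lborel_vec (2*k))" if "i \<in> N" for i
    using measurable_component_singleton[OF that, of "\<lambda>_. lborel"] by simp
  have [measurable]: "Measurable.pred (lborel_vec (2*k)) (\<lambda>s. s \<in> cone)"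
    unfolding cone_def mem_Collect_eq
    by (intro pred_intros_logic pred_intros_finite borel_measurable_pred_less borel_measurable_const comp) (use k in auto)
  have [measurable]: "(\<lambda>s. s (2*k)) \<in> borel_measurable (lborel_vec (2*k))"
    by (rule comp) (use k in auto)
  note [measurable] = measurable_hyp_integrand
  show ?thesis unfolding Psi_def[abs_def] by measurable
qed

lemma Psi_psum:
  assumes "r > 0"
  shows "Psi H t (psum r (2*k) w) =
    of_real r powr (of_nat k * (2*H - 2)) * (indicator {w. sum w N < t / r} w *\<^sub>R W (2*H - 2) w)"
proof -
  have "psum r (2*k) w (2*k) < t \<longleftrightarrow> sum w N < t / r"
    using k assms by (simp add: psum_def field_simps)
  then show ?thesis
    using psum_in_cone_iff[OF assms, of w] hyp_integrand_psum[OF assms, of w H]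
    by (auto simp: Psi_def W_def indicator_def)
qed

lemma Psi_scaling:
  assumes "r > 0"
  shows "(LINT w|lborel_vec (2*k). indicator {w. sum w N < r} w *\<^sub>R W (2*H - 2) w) =
    of_real r powr (of_nat (2*k) + of_nat k * (2*H - 2)) * (LINT s|lborel_vec (2*k). Psi H 1 s)"
proof -
  let ?c = "of_nat k * (2*H - 2)"
  \<comment> \<open>The substitution with factor \<open>u\<close> is used three ways:
    \<open>u = 1\<close> identifies the integrals of \<open>W\<close> and \<open>Psi\<close> at side
    \<open>r\<close> and at side 1, and \<open>u = r\<close> reduces side \<open>r\<close> to side
    1.\<close>
  have *: "(LINT s|lborel_vec (2*k). Psi H t s) = of_real (u ^ (2*k)) * (of_real u powr ?c *
      (LINT w|lborel_vec (2*k). indicator {w. sum w N < t / u} w *\<^sub>R W (2*H - 2) w))" if "u > 0" for t u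
    unfolding integral_psum[OF that measurable_Psi] Psi_psum[OF that] by (simp only: integral_mult_right_zero)
  have "(LINT w|lborel_vec (2*k). indicator {w. sum w N < r} w *\<^sub>R W (2*H - 2) w) = (LINT s|lborel_vec (2*k). Psi H r s)"
    using *[of 1 r] by simp
  also have "\<dots> = of_real (r ^ (2*k)) * (of_real r powr ?c * (LINT s|lborel_vec (2*k). Psi H 1 s))"
    using *[OF assms, of r] *[of 1 1] assms by simp
  also have "complex_of_real (r ^ (2*k)) = of_real r powr (of_nat (2*k))"
  proof -
    have "of_real r powr (of_nat n) = (of_real r ^ n :: complex)" for n
      using assms by (simp add: powr_def exp_of_nat_mult)
    from this[of "2*k"] show ?thesis by (simp only: of_real_power)
  qed
  finally show ?thesis using assms by (simp add: powr_add mult.assoc)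
qed

lemma indicator_simplex_hyp_integrand:
  assumes "s \<in> space (lborel_vec (2*k))"
  shows "indicator (incr_simplex (2*k)) s *\<^sub>R hyp_integrand P H s = Psi H 1 s"
  using assms by (auto simp: Psi_def incr_simplex_def cone_def indicator_def)

lemma hyp_integral_Psi: "hyp_integral k P H = (LINT s|lborel_vec (2*k). Psi H 1 s)"
  unfolding hyp_integral_def set_lebesgue_integral_def
  by (rule Bochner_Integration.integral_cong[OF refl indicator_simplex_hyp_integrand])

lemma set_integrable_hyp_integrand:
  assumes "Re H > 1/2"
  shows "set_integrable (lborel_vec (2*k)) (incr_simplex (2*k)) (hyp_integrand P H)"
proof -
  let ?z = "2*H - 2"
  have z: "-1 < Re ?z" using assms by simp
  \<comment> \<open>On the simplex of side 1 the weight \<open>exp (- sum w N)\<close> is at least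
    \<open>exp (-1)\<close>, so \<open>exp 1\<close> times \<open>Phi\<close> dominates the
    integrand.\<close>
  have "integrable (lborel_vec (2*k)) (\<lambda>w. of_real (exp 1) * Phi N (expo (\<lambda>_. 0) ?z) w)"
    by (rule integrable_mult_right) (rule integrable_Phi_expo[OF z])
  then have "integrable (lborel_vec (2*k)) (\<lambda>w. Psi H 1 (psum 1 (2*k) w))"
  proof (rule Bochner_Integration.integrable_bound)
    show "(\<lambda>w. Psi H 1 (psum 1 (2*k) w)) \<in> borel_measurable (lborel_vec (2*k))"
      by (rule measurable_compose[OF measurable_psum measurable_Psi])
    have "norm (Psi H 1 (psum 1 (2*k) w)) \<le> norm (of_real (exp 1) * Phi N (expo (\<lambda>_. 0) ?z) w)" for w
    proof (cases "sum w N < 1")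
      case True
      then have "1 \<le> exp 1 * exp (- sum w N)" by (simp flip: exp_add)
      then have "1 * norm (W ?z w) \<le> (exp 1 * exp (- sum w N)) * norm (W ?z w)"
        by (intro mult_right_mono) auto
      moreover have "norm (Psi H 1 (psum 1 (2*k) w)) = norm (W ?z w)"
        using True Psi_psum[of 1 H 1 w] by (simp add: indicator_def)
      moreover have "norm (of_real (exp 1) * Phi N (expo (\<lambda>_. 0) ?z) w) = (exp 1 * exp (- sum w N)) * norm (W ?z w)"
        unfolding Phi_W norm_mult norm_of_real by simp
      ultimately show ?thesis by (simp only: mult_1_left)
    next
      case False
      then show ?thesis using Psi_psum[of 1 H 1 w] by (simp add: indicator_def)
    qed
    then show "AE w in lborel_vec (2*k). norm (Psi H 1 (psum 1 (2*k) w)) \<le> norm (of_real (exp 1) * Phi N (expo (\<lambda>_. 0) ?z) w)"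
      by (rule AE_I2)
  qed
  then have "integrable (lborel_vec (2*k)) (Psi H 1)"
    by (rule integrable_psum_iff[OF measurable_Psi, THEN iffD2])
  moreover have "integrable (lborel_vec (2*k)) (\<lambda>s. indicator (incr_simplex (2*k)) s *\<^sub>R hyp_integrand P H s) \<longleftrightarrow>
      integrable (lborel_vec (2*k)) (Psi H 1)"
    by (rule Bochner_Integration.integrable_cong[OF refl]) (rule indicator_simplex_hyp_integrand)
  ultimately show ?thesis unfolding set_integrable_def by blast
qed

lemma Jint_hyp_integral:
  assumes "Re H > 1/2"
  shows "Jint N (expo (\<lambda>_. 0) (2*H - 2)) = Gamma (of_nat (2*k) + of_nat k * (2*H - 2) + 1) * hyp_integral k P H"
proof -
  let ?z = "2*H - 2"
  have z: "-1 < Re ?z" using assms by simp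
  have "Jint N (expo (\<lambda>_. 0) ?z) = (LINT w|lborel_vec (2*k). W ?z w * of_real (exp (- sum w N)))"
    unfolding Jint_def Phi_W ..
  also have "\<dots> = Gamma (of_nat (2*k) + of_nat k * ?z + 1) * (LINT s|lborel_vec (2*k). Psi H 1 s)"
  proof (rule laplace_homogeneous[OF fin measurable_W])
    show "integrable (lborel_vec (2*k)) (\<lambda>w. W ?z w * of_real (exp (- sum w N)))"
      using integrable_Phi_expo[OF z] unfolding Phi_W[abs_def] .
    show "0 < sum w N" if "W ?z w \<noteq> 0" for w
    proof (rule sum_pos[OF fin ne])
      show "0 < w i" if "i \<in> N" for i
        using \<open>W ?z w \<noteq> 0\<close> that unfolding W_def by metis
    qed
    have "real k * (-1) \<le> real k * Re ?z" using z by (intro mult_left_mono) auto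
    then show "-1 < Re (of_nat (2*k) + of_nat k * ?z)" by simp
  qed (rule Psi_scaling)
  finally show ?thesis by (simp only: hyp_integral_Psi)
qed

section \<open>Location of the poles\<close>

lemma scal_dim_expo0:
  assumes "S \<in> subs N"
  shows "scal_dim (expo (\<lambda>_. 0) (2*H - 2)) S = of_nat (card S) + of_nat (bracket S P) * (2*H - 2)"
  unfolding scal_dim_expo sum_m[OF assms] by simp

text \<open>Setting the exponent equal to \<open>- l\<close> is a linear equation for
  \<open>H\<close>. When \<open>bracket S P = 0\<close> the exponent is the positive constant
  \<open>card S\<close>, so such a set causes no pole.\<close>

lemma scal_dim_nonpos_Ints_imp_progressions:
  assumes S: "S \<in> subs N" and "scal_dim (expo (\<lambda>_. 0) (2*H - 2)) S \<in> \<int>\<^sub>\<le>\<^sub>0"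
  shows "H \<in> progressions k P"
proof -
  obtain l where "scal_dim (expo (\<lambda>_. 0) (2*H - 2)) S = - of_nat l"
    using assms(2) by (rule nonpos_Ints_cases')
  then have l: "of_nat (bracket S P) * (2*H - 2) = - of_nat (card S + l)"
    unfolding scal_dim_expo0[OF S] by (simp add: algebra_simps add_eq_0_iff)
  have "S \<subseteq> N" "S \<noteq> {}" "finite S" using S by (auto simp: subs_def intro: finite_subset)
  then have card: "card S > 0" by (simp add: card_gt_0_iff)
  have "bracket S P > 0"
  proof (rule ccontr)
    assume "\<not> bracket S P > 0"
    then have "of_nat (card S + l) = (0 :: complex)" using l \<open>\<not> bracket S P > 0\<close> by (simp del: of_nat_add)
    then show False using card unfolding of_nat_eq_0_iff by simp
  qed
  moreover have "H = 1 - of_nat (card S + l) / of_nat (2 * bracket S P)"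
  proof -
    have "complex_of_nat (2 * bracket S P) \<noteq> 0" using \<open>bracket S P > 0\<close> unfolding of_nat_eq_0_iff by simp
    moreover have "of_nat (2 * bracket S P) * (H - 1) = - of_nat (card S + l)"
      using l by (simp add: algebra_simps)
    ultimately have "H - 1 = - of_nat (card S + l) / of_nat (2 * bracket S P)"
      by (metis nonzero_mult_div_cancel_left)
    then have "H - 1 = - (of_nat (card S + l) / of_nat (2 * bracket S P))"
      by (simp only: minus_divide_left)
    then show ?thesis by (metis add.commute diff_add_cancel uminus_add_conv_diff)
  qed
  ultimately show ?thesis using \<open>S \<subseteq> N\<close> unfolding progressions_def by blast
qed

lemma progressions_Rats: "progressions k P \<subseteq> \<rat>"
  by (auto simp: progressions_def intro!: Rats_diff Rats_divide Rats_add Rats_mult)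

lemma meromorphic_continuation:
  "\<exists>F. F meromorphic_on UNIV \<and> (\<forall>H. Re H > 1/2 \<longrightarrow> F H = hyp_integral k P H) \<and>
     F holomorphic_on (UNIV - progressions k P)"
proof -
  let ?sd = "\<lambda>H S. scal_dim (expo (\<lambda>_. 0) (2*H - 2)) S"
  obtain E where E: "E holomorphic_on UNIV"
    and E_eq: "\<And>z. -1 < Re z \<Longrightarrow> E z = Jint N (expo (\<lambda>_. 0) z) * (\<Prod>S\<in>subs N. rGamma (scal_dim (expo (\<lambda>_. 0) z) S))"
    using entire_extension by blast
  \<comment> \<open>This equals \<open>2*k*H + 1\<close>, the argument of the Gamma factor that
    relates \<open>Jint\<close> to the integral over the simplex.\<close>
  define e where "e H = of_nat (2*k) + of_nat k * (2*H - 2) + (1::complex)" for H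
  define G where "G H = E (2*H - 2) * rGamma (e H)" for H
  \<comment> \<open>Inverses of entire functions make meromorphy immediate. At zeros of
    \<open>rGamma\<close> the inverse takes the default value 0, which does not affect
    meromorphy.\<close>
  define F where "F H = G H * (\<Prod>S\<in>subs N. inverse (rGamma (?sd H S)))" for H
  have "(E \<circ> (\<lambda>H. 2*H - 2)) holomorphic_on UNIV"
    by (rule holomorphic_on_compose) (auto intro!: holomorphic_intros holomorphic_on_subset[OF E])
  then have "(\<lambda>H. E (2*H - 2)) holomorphic_on UNIV" by (simp add: o_def)
  then have G: "G holomorphic_on UNIV"
    unfolding G_def e_def by (intro holomorphic_intros holomorphic_rGamma')
  have rG: "(\<lambda>H. rGamma (?sd H S)) holomorphic_on UNIV" for S
    unfolding scal_dim_expo by (intro holomorphic_intros holomorphic_rGamma')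
  have "F meromorphic_on UNIV"
    unfolding F_def using G rG
    by (intro meromorphic_intros analytic_on_imp_meromorphic_on) (auto simp: analytic_on_open)
  moreover have "F holomorphic_on (UNIV - progressions k P)"
    unfolding F_def
  proof (intro holomorphic_on_mult holomorphic_on_prod holomorphic_on_inverse)
    show "G holomorphic_on (UNIV - progressions k P)" using G by (rule holomorphic_on_subset) simp
    show "(\<lambda>H. rGamma (?sd H S)) holomorphic_on (UNIV - progressions k P)" for S
      using rG by (rule holomorphic_on_subset) simp
    show "rGamma (?sd H S) \<noteq> 0" if "S \<in> subs N" "H \<in> UNIV - progressions k P" for S H
      using scal_dim_nonpos_Ints_imp_progressions[OF that(1), of H] that(2)
      by (auto simp: rGamma_eq_zero_iff)
  qed
  moreover have "F H = hyp_integral k P H" if H: "Re H > 1/2" for H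
  proof -
    have z: "-1 < Re (2*H - 2)" using H by simp
    have nz: "rGamma (?sd H S) \<noteq> 0" if "S \<in> subs N" for S
    proof -
      have "0 < Re (?sd H S)" using scal_dim_expo_pos[OF that, of 1 "2*H - 2" 0 "\<lambda>_. 0"] z by simp
      then show ?thesis by (auto simp: rGamma_eq_zero_iff elim!: nonpos_Ints_cases)
    qed
    have "real k * (-1) \<le> real k * Re (2*H - 2)" using z by (intro mult_left_mono) auto
    then have "0 < Re (e H)" by (simp add: e_def)
    then have "e H \<notin> \<int>\<^sub>\<le>\<^sub>0" by (auto elim!: nonpos_Ints_cases)
    then have "Gamma (e H) * rGamma (e H) = 1"
      by (simp add: rGamma_inverse_Gamma Gamma_eq_zero_iff)
    moreover have "(\<Prod>S\<in>subs N. rGamma (?sd H S)) * (\<Prod>S\<in>subs N. inverse (rGamma (?sd H S))) = 1"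
      unfolding prod.distrib[symmetric] by (rule prod.neutral) (use nz in auto)
    moreover have "F H = hyp_integral k P H * (Gamma (e H) * rGamma (e H)) *
        ((\<Prod>S\<in>subs N. rGamma (?sd H S)) * (\<Prod>S\<in>subs N. inverse (rGamma (?sd H S))))"
      unfolding F_def G_def E_eq[OF z] Jint_hyp_integral[OF H] e_def by (simp only: mult_ac)
    ultimately show ?thesis by simp
  qed
  ultimately show ?thesis by blast
qed

end

theorem theorem0p1:
  fixes k :: nat and P :: "nat set set"
  assumes "k \<ge> 1" and "pair_partition k P"
  shows "(\<forall>H. Re H > 1/2 \<longrightarrow>
            set_integrable (lborel_vec (2*k)) (incr_simplex (2*k)) (hyp_integrand P H))
       \<and> (\<exists>F. F meromorphic_on UNIV
            \<and> (\<forall>H. Re H > 1/2 \<longrightarrow> F H = hyp_integral k P H)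
            \<and> F holomorphic_on (UNIV - progressions k P))
       \<and> progressions k P \<subseteq> \<rat>"
proof -
  interpret pairing k P using assms by unfold_locales
  show ?thesis
    using set_integrable_hyp_integrand meromorphic_continuation progressions_Rats by blast
qed

end
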